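(* Let $K\subset[-1,1]$ be compact, regarded as a subset of the line $\{y=0\}$ in $\mathbb{R}^2$. Then there exist functions $\Lambda^\pm\in C^\infty(B_1)\setminus C^\omega(B_1)$ (depending on $K$) and a solution $u$ of the two-phase Bernoulli problem in $B_1\subset\mathbb{R}^2$ with coefficients $\Lambda^\pm$ (as defined in the context) such that $\mathcal B(u)=\partial K$.
   Context: $C^\omega$ denotes real-analytic functions. Given positive functions $\Lambda^\pm$ on $B_1$, for $u\in C^{0,1}(B_1)$ set $u^\pm:=\max(\pm u,0)$ and $\Omega_\pm:=\{\pm u>0\}\cap B_1$. We say that $u$ is a solution of the two-phase Bernoulli problem in $B_1$ with coefficients $\Lambda^\pm$ if, for some $\alpha\in(0,1)$, the free boundaries $\partial\Omega_\pm\cap B_1$ are $C^{1,\alpha}$-regular, $u^\pm\in C^{1,\alpha}(\overline{\Omega_\pm}\cap B_1)$, and $\Delta u^\pm=0$ in $\Omega_\pm$; $u^\pm=0$ on $\partial\Omega_\pm\cap B_1$; $|\nabla u^\pm|^2=\Lambda^\pm$ on $(\partial\Omega_\pm\setminus\partial\Omega_\mp)\cap B_1$; $|\nabla u^\pm|^2\ge\Lambda^\pm$ on $\partial\Omega_+\cap\partial\Omega_-\cap B_1$; and $|\nabla u^+|^2-|\nabla u^-|^2=\Lambda^+-\Lambda^-$ on $\partial\Omega_+\cap\partial\Omega_-\cap B_1$ (gradients on the boundary being boundary values from $\overline{\Omega_\pm}$). The branching set is $\mathcal B(u):=\partial\Omega_+\cap\partial\Omega_-\cap\overline{\mathrm{int}(\{u=0\})}$.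 *)

theory Defs
  imports "HOL-Analysis.Analysis"
begin

type_synonym R2 = "real \<times> real"

definition B1 :: "R2 set" where
  "B1 = ball (0,0) 1"

fun Ck_on :: "nat \<Rightarrow> R2 set \<Rightarrow> (R2 \<Rightarrow> real) \<Rightarrow> bool" where
  "Ck_on 0 S f = continuous_on S f"
| "Ck_on (Suc k) S f =
     (\<exists>g1 g2. (\<forall>x\<in>S. (f has_derivative (\<lambda>h. g1 x * fst h + g2 x * snd h)) (at x))
              \<and> Ck_on k S g1 \<and> Ck_on k S g2)"

definition smooth_on :: "R2 set \<Rightarrow> (R2 \<Rightarrow> real) \<Rightarrow> bool" where
  "smooth_on S f \<longleftrightarrow> (\<forall>k. Ck_on k S f)"

definition real_analytic_on :: "R2 set \<Rightarrow> (R2 \<Rightarrow> real) \<Rightarrow> bool" where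
  "real_analytic_on S f \<longleftrightarrow>
     (\<forall>p\<in>S. \<exists>r>0. \<exists>a :: nat \<Rightarrow> nat \<Rightarrow> real. \<forall>x\<in>ball p r.
        ((\<lambda>(i,j). a i j * (fst x - fst p) ^ i * (snd x - snd p) ^ j) has_sum f x) UNIV)"

definition harmonic_on :: "R2 set \<Rightarrow> (R2 \<Rightarrow> real) \<Rightarrow> bool" where
  "harmonic_on S f \<longleftrightarrow>
     (\<exists>(grad :: R2 \<Rightarrow> R2) (H :: R2 \<Rightarrow> R2 \<Rightarrow> R2).
        (\<forall>x\<in>S. (f has_derivative (\<lambda>h. grad x \<bullet> h)) (at x)
               \<and> (grad has_derivative H x) (at x)
               \<and> fst (H x (1,0)) + snd (H x (0,1)) = 0)
        \<and> continuous_on S (\<lambda>x. H x (1,0)) \<and> continuous_on S (\<lambda>x. H x (0,1)))"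

definition C1alpha_real :: "real \<Rightarrow> (real \<Rightarrow> real) \<Rightarrow> bool" where
  "C1alpha_real \<alpha> g \<longleftrightarrow>
     (\<exists>g'. (\<forall>t. (g has_real_derivative g' t) (at t)) \<and>
           (\<exists>C. \<forall>s t. \<bar>g' s - g' t\<bar> \<le> C * \<bar>s - t\<bar> powr \<alpha>))"

definition C1alpha_boundary :: "real \<Rightarrow> R2 set \<Rightarrow> R2 set \<Rightarrow> bool" where
  "C1alpha_boundary \<alpha> U \<Omega> \<longleftrightarrow>
     (\<forall>p \<in> frontier \<Omega> \<inter> U. \<exists>r>0. \<exists>e :: R2. \<exists>g. norm e = 1 \<and> C1alpha_real \<alpha> g \<and>
        (\<forall>x\<in>ball p r. x \<in> \<Omega> \<longleftrightarrow> (x - p) \<bullet> e > g ((x - p) \<bullet> (- snd e, fst e))))"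

text \<open>f \<in> C^{1,alpha}(S) with gradient G on S (G is the gradient in the interior of S and
  a locally alpha-Hoelder continuous function on S, so its values on the boundary are the
  boundary values of the gradient).\<close>
definition C1alpha_grad :: "real \<Rightarrow> R2 set \<Rightarrow> (R2 \<Rightarrow> real) \<Rightarrow> (R2 \<Rightarrow> R2) \<Rightarrow> bool" where
  "C1alpha_grad \<alpha> S f G \<longleftrightarrow>
     continuous_on S f \<and>
     (\<forall>x\<in>interior S. (f has_derivative (\<lambda>h. G x \<bullet> h)) (at x)) \<and>
     (\<forall>x\<in>S. \<exists>r>0. \<exists>C. \<forall>y\<in>S \<inter> ball x r. \<forall>z\<in>S \<inter> ball x r.
         norm (G y - G z) \<le> C * dist y z powr \<alpha>)"

definition pos_part :: "(R2 \<Rightarrow> real) \<Rightarrow> R2 \<Rightarrow> real" where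
  "pos_part u x = max (u x) 0"

definition neg_part :: "(R2 \<Rightarrow> real) \<Rightarrow> R2 \<Rightarrow> real" where
  "neg_part u x = max (- u x) 0"

definition Omega_plus :: "(R2 \<Rightarrow> real) \<Rightarrow> R2 set" where
  "Omega_plus u = {x. u x > 0} \<inter> B1"

definition Omega_minus :: "(R2 \<Rightarrow> real) \<Rightarrow> R2 set" where
  "Omega_minus u = {x. - u x > 0} \<inter> B1"

definition two_phase_solution ::
  "(R2 \<Rightarrow> real) \<Rightarrow> (R2 \<Rightarrow> real) \<Rightarrow> (R2 \<Rightarrow> real) \<Rightarrow> bool" where
  "two_phase_solution \<Lambda>p \<Lambda>m u \<longleftrightarrow>
     (\<exists>L. L-lipschitz_on B1 u) \<and>
     (\<exists>\<alpha>. 0 < \<alpha> \<and> \<alpha> < 1 \<and>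
        (let Op = Omega_plus u; Om = Omega_minus u in
         C1alpha_boundary \<alpha> B1 Op \<and> C1alpha_boundary \<alpha> B1 Om \<and>
         (\<exists>Gp Gm.
            C1alpha_grad \<alpha> (closure Op \<inter> B1) (pos_part u) Gp \<and>
            C1alpha_grad \<alpha> (closure Om \<inter> B1) (neg_part u) Gm \<and>
            harmonic_on Op (pos_part u) \<and> harmonic_on Om (neg_part u) \<and>
            (\<forall>x \<in> frontier Op \<inter> B1. pos_part u x = 0) \<and>
            (\<forall>x \<in> frontier Om \<inter> B1. neg_part u x = 0) \<and>
            (\<forall>x \<in> (frontier Op - frontier Om) \<inter> B1. (norm (Gp x))\<^sup>2 = \<Lambda>p x) \<and>
            (\<forall>x \<in> (frontier Om - frontier Op) \<inter> B1. (norm (Gm x))\<^sup>2 = \<Lambda>m x) \<and>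
            (\<forall>x \<in> frontier Op \<inter> frontier Om \<inter> B1.
               (norm (Gp x))\<^sup>2 \<ge> \<Lambda>p x \<and> (norm (Gm x))\<^sup>2 \<ge> \<Lambda>m x \<and>
               (norm (Gp x))\<^sup>2 - (norm (Gm x))\<^sup>2 = \<Lambda>p x - \<Lambda>m x))))"

definition branching_set :: "(R2 \<Rightarrow> real) \<Rightarrow> R2 set" where
  "branching_set u = frontier (Omega_plus u) \<inter> frontier (Omega_minus u) \<inter>
      closure (interior {x \<in> B1. u x = 0})"

end

theory Submission
  imports Defs "HOL-Complex_Analysis.Cauchy_Integral_Formula"
begin

text \<open>
  Let \<open>F\<close> be the frontier of \<open>K\<close>. The negative phase is trivial: \<open>u = y\<close> on \<open>{y < 0}\<close>. For the positive
  phase choose a smooth compactly supported \<open>\<psi> \<ge> 0\<close> that vanishes on \<open>[-2, 2]\<close> exactly at \<open>F\<close>, and let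
  \<open>H\<close> be a small multiple of its Cauchy integral, so that \<open>H\<close> is holomorphic in the upper half plane,
  smooth up to the real axis, and \<open>Im H = \<epsilon> \<psi>\<close> there. Then \<open>v = y - Im H\<close> is harmonic and strictly
  increasing in \<open>y\<close>, and \<open>v(x, 0) = - \<epsilon> \<psi>(x) \<le> 0\<close>, so \<open>{v = 0}\<close> is a graph \<open>y = g(x) \<ge> 0\<close> that touches the
  line \<open>y = 0\<close> exactly over \<open>F\<close>. With \<open>u = v\<close> on \<open>{y > g(x)}\<close> and \<open>u = 0\<close> in between, the coefficient
  \<open>\<Lambda>\<^sup>+(x, y) = |1 - H'(x + \<i> g(x))|\<^sup>2\<close> (and \<open>\<Lambda>\<^sup>- = 1\<close>) is smooth because \<open>H\<close> is smooth up to the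
  boundary, and adding a flat function supported in \<open>y \<ge> 1/2\<close> makes both coefficients non-analytic.
\<close>

section \<open>Smooth functions of one variable\<close>

fun Ck_real_on :: "nat \<Rightarrow> real set \<Rightarrow> (real \<Rightarrow> real) \<Rightarrow> bool" where
  "Ck_real_on 0 S f = continuous_on S f"
| "Ck_real_on (Suc k) S f =
     (\<exists>f'. (\<forall>x\<in>S. (f has_real_derivative f' x) (at x)) \<and> Ck_real_on k S f')"

lemma Ck_real_on_SucD: "Ck_real_on (Suc k) S f \<Longrightarrow> Ck_real_on k S f"
proof (induction k arbitrary: f)
  case 0
  then show ?case
    by (auto intro!: continuous_at_imp_continuous_on dest: DERIV_isCont)
qed auto

lemma Ck_real_on_const: "Ck_real_on k S (\<lambda>x. c)"
proof (induction k arbitrary: c)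
  case (Suc k)
  then show ?case
    by (auto intro!: exI[of _ "\<lambda>x. 0"] derivative_eq_intros)
qed auto

lemma Ck_real_on_add:
  "Ck_real_on k S f \<Longrightarrow> Ck_real_on k S g \<Longrightarrow> Ck_real_on k S (\<lambda>x. f x + g x)"
proof (induction k arbitrary: f g)
  case (Suc k)
  then obtain f' g' where "\<forall>x\<in>S. (f has_real_derivative f' x) (at x)" "Ck_real_on k S f'"
    "\<forall>x\<in>S. (g has_real_derivative g' x) (at x)" "Ck_real_on k S g'"
    by auto
  with Suc.IH show ?case
    by (auto intro!: exI[of _ "\<lambda>x. f' x + g' x"] derivative_eq_intros)
qed (auto intro: continuous_intros)

lemma Ck_real_on_mult:
  "Ck_real_on k S f \<Longrightarrow> Ck_real_on k S g \<Longrightarrow> Ck_real_on k S (\<lambda>x. f x * g x)"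
proof (induction k arbitrary: f g)
  case (Suc k)
  then obtain f' g' where *: "\<forall>x\<in>S. (f has_real_derivative f' x) (at x)" "Ck_real_on k S f'"
    "\<forall>x\<in>S. (g has_real_derivative g' x) (at x)" "Ck_real_on k S g'"
    by auto
  have "Ck_real_on k S f" "Ck_real_on k S g"
    using Suc.prems by (auto dest: Ck_real_on_SucD simp del: Ck_real_on.simps)
  with * Suc.IH have "Ck_real_on k S (\<lambda>x. f' x * g x + g' x * f x)"
    by (intro Ck_real_on_add) auto
  with * show ?case
    by (auto intro!: exI[of _ "\<lambda>x. f' x * g x + g' x * f x"] DERIV_mult)
qed (auto intro: continuous_intros)

lemma Ck_real_on_minus: "Ck_real_on k S f \<Longrightarrow> Ck_real_on k S (\<lambda>x. - f x)"
  using Ck_real_on_mult[OF Ck_real_on_const[of k S "-1"], of f] by simp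

lemma Ck_real_on_inverse:
  assumes "\<And>x. x \<in> S \<Longrightarrow> f x \<noteq> 0"
  shows "Ck_real_on k S f \<Longrightarrow> Ck_real_on k S (\<lambda>x. inverse (f x))"
proof (induction k)
  case 0
  then show ?case using assms by (auto intro!: continuous_intros)
next
  case (Suc k)
  then obtain f' where f': "\<forall>x\<in>S. (f has_real_derivative f' x) (at x)" "Ck_real_on k S f'"
    by auto
  have "Ck_real_on k S (\<lambda>x. inverse (f x))"
    using Suc by (auto dest: Ck_real_on_SucD simp del: Ck_real_on.simps)
  then have "Ck_real_on k S (\<lambda>x. - (inverse (f x) * f' x * inverse (f x)))"
    using f' by (intro Ck_real_on_minus Ck_real_on_mult)
  with f' assms show ?case
    by (auto intro!: exI[of _ "\<lambda>x. - (inverse (f x) * f' x * inverse (f x))"] DERIV_inverse')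
qed

lemma Ck_real_on_affine:
  "Ck_real_on k UNIV f \<Longrightarrow> Ck_real_on k UNIV (\<lambda>x. f (a * x + b))"
proof (induction k arbitrary: f)
  case 0
  then show ?case
    by (auto intro!: continuous_intros continuous_on_compose2[of UNIV f])
next
  case (Suc k)
  then obtain f' where f': "\<And>x. (f has_real_derivative f' x) (at x)" "Ck_real_on k UNIV f'"
    by auto
  have "((\<lambda>x. f (a * x + b)) has_real_derivative f' (a * x + b) * a) (at x)" for x
    by (rule DERIV_chain2[OF f'(1)]) (auto intro!: derivative_eq_intros)
  moreover have "Ck_real_on k UNIV (\<lambda>x. f' (a * x + b) * a)"
    by (intro Ck_real_on_mult Ck_real_on_const Suc.IH f')
  ultimately show ?case by (auto intro!: exI[of _ "\<lambda>x. f' (a * x + b) * a"])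
qed

lemma Ck_real_derivative_sequence:
  assumes "\<And>k. Ck_real_on k UNIV f"
  obtains D where "D 0 = f" "\<And>k x. (D k has_real_derivative D (Suc k) x) (at x)"
proof
  define D where "D = (\<lambda>k. (deriv ^^ k) f)"
  show "D 0 = f" by (simp add: D_def)
  have *: "Ck_real_on k UNIV (deriv h) \<and> (h has_real_derivative deriv h x) (at x)"
    if h: "\<And>k. Ck_real_on k UNIV h" for h :: "real \<Rightarrow> real" and k x
  proof -
    obtain h' where h': "\<And>x. (h has_real_derivative h' x) (at x)" "Ck_real_on k UNIV h'"
      using h[of "Suc k"] by auto
    then have "deriv h = h'" by (auto intro: DERIV_imp_deriv)
    with h' show ?thesis by simp
  qed
  have C: "Ck_real_on j UNIV (D k)" for j k
  proof (induction k arbitrary: j)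
    case 0
    then show ?case by (simp add: D_def assms)
  next
    case (Suc k)
    then show ?case using *[of "D k" j] by (auto simp: D_def)
  qed
  show "(D k has_real_derivative D (Suc k) x) (at x)" for k x
    using *[OF C] by (simp add: D_def)
qed

lemma Ck_on_add_separate:
  assumes "Ck_real_on k A f" "Ck_real_on k UNIV g" "S \<subseteq> A \<times> UNIV"
  shows "Ck_on k S (\<lambda>p. f (fst p) + g (snd p))"
  using assms(1,2)
proof (induction k arbitrary: f g)
  case 0
  have "continuous_on S (\<lambda>p. f (fst p))" "continuous_on S (\<lambda>p. g (snd p))"
    using 0 assms(3)
    by (auto intro!: continuous_on_compose2[of A f] continuous_on_compose2[of UNIV g] continuous_intros)
  then show ?case by (auto intro: continuous_intros)
next
  case (Suc k)
  then obtain f' g' where *: "\<And>x. x \<in> A \<Longrightarrow> (f has_real_derivative f' x) (at x)" "Ck_real_on k A f'"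
    "\<And>x. (g has_real_derivative g' x) (at x)" "Ck_real_on k UNIV g'"
    unfolding Ck_real_on.simps by blast
  have "((\<lambda>p. f (fst p) + g (snd p)) has_derivative
      (\<lambda>h. (f' (fst p) + 0) * fst h + (0 + g' (snd p)) * snd h)) (at p)" if "p \<in> S" for p
  proof -
    have "fst p \<in> A" using that assms(3) by auto
    have "((\<lambda>p. f (fst p)) has_derivative (\<lambda>h. f' (fst p) * fst h)) (at p)"
      by (rule has_derivative_compose[of fst fst, OF _ *(1)[OF \<open>fst p \<in> A\<close>, unfolded has_field_derivative_def]])
        (rule has_derivative_fst[OF has_derivative_ident])
    moreover have "((\<lambda>p. g (snd p)) has_derivative (\<lambda>h. g' (snd p) * snd h)) (at p)"
      by (rule has_derivative_compose[of snd snd, OF _ *(3)[unfolded has_field_derivative_def]])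
        (rule has_derivative_snd[OF has_derivative_ident])
    ultimately show ?thesis
      by (auto intro: has_derivative_add)
  qed
  moreover have "Ck_on k S (\<lambda>p. f' (fst p) + 0)" "Ck_on k S (\<lambda>p. 0 + g' (snd p))"
    using Suc.IH[OF *(2) Ck_real_on_const[of k UNIV 0]]
      Suc.IH[OF Ck_real_on_const[of k A 0] *(4)] by simp_all
  ultimately show ?case
    unfolding Ck_on.simps
    by (intro exI[of _ "\<lambda>p. f' (fst p) + 0"] exI[of _ "\<lambda>p. 0 + g' (snd p)"] conjI ballI)
qed

definition poly_exp_inv :: "real poly \<Rightarrow> real \<Rightarrow> real" where
  "poly_exp_inv P x = (if x > 0 then poly P (1 / x) * exp (- (1 / x)) else 0)"

lemma tendsto_poly_div_exp: "((\<lambda>x. poly P x / exp x) \<longlongrightarrow> (0::real)) at_top"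
proof -
  have "((\<lambda>x. \<Sum>i\<le>degree P. coeff P i * (x ^ i / exp x)) \<longlongrightarrow> (\<Sum>i\<le>degree P. coeff P i * 0)) at_top"
    by (intro tendsto_intros tendsto_power_div_exp_0)
  then show ?thesis
    by (simp add: poly_altdef sum_divide_distrib)
qed

lemma tendsto_poly_exp_inv: "(poly_exp_inv P \<longlongrightarrow> 0) (at 0)"
proof (rule filterlim_split_at)
  have "((\<lambda>x. poly P (inverse x) / exp (inverse x)) \<longlongrightarrow> 0) (at_right (0::real))"
    by (rule filterlim_compose[OF tendsto_poly_div_exp filterlim_inverse_at_top_right])
  then show "(poly_exp_inv P \<longlongrightarrow> 0) (at_right 0)"
    by (rule Lim_transform_eventually)
      (auto simp: eventually_at_filter poly_exp_inv_def exp_minus field_simps)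
  show "(poly_exp_inv P \<longlongrightarrow> 0) (at_left 0)"
    by (rule tendsto_eventually) (auto simp: eventually_at_filter poly_exp_inv_def)
qed

lemma has_derivative_poly_exp_inv:
  "(poly_exp_inv P has_real_derivative poly_exp_inv ([:0, 0, 1:] * (P - pderiv P)) x) (at x)"
proof -
  consider "x > 0" | "x = 0" | "x < 0" by linarith
  then show ?thesis
  proof cases
    case 1
    have "((\<lambda>x. poly P (1 / x) * exp (- (1 / x))) has_real_derivative
       poly_exp_inv ([:0, 0, 1:] * (P - pderiv P)) x) (at x)"
      using 1 by (auto intro!: derivative_eq_intros DERIV_chain2[OF poly_DERIV]
          simp: poly_exp_inv_def field_simps power2_eq_square)
    then show ?thesis
      by (rule has_field_derivative_transform_within[where d = x]) (use 1 in \<open>auto simp: poly_exp_inv_def dist_real_def\<close>)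
  next
    case 2
    have "((\<lambda>y. poly_exp_inv ([:0, 1:] * P) y) \<longlongrightarrow> 0) (at 0)"
      by (rule tendsto_poly_exp_inv)
    then have "((\<lambda>y. (poly_exp_inv P y - poly_exp_inv P 0) / (y - 0)) \<longlongrightarrow> 0) (at 0)"
      by (rule Lim_transform_eventually)
        (auto simp: poly_exp_inv_def eventually_at_filter field_simps)
    then show ?thesis
      using 2 by (simp add: has_field_derivative_iff poly_exp_inv_def)
  next
    case 3
    have "((\<lambda>x. 0) has_real_derivative poly_exp_inv ([:0, 0, 1:] * (P - pderiv P)) x) (at x)"
      using 3 by (simp add: poly_exp_inv_def)
    then show ?thesis
      by (rule has_field_derivative_transform_within[where d = "- x"]) (use 3 in \<open>auto simp: poly_exp_inv_def dist_real_def\<close>)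
  qed
qed

lemma Ck_real_poly_exp_inv: "Ck_real_on k UNIV (poly_exp_inv P)"
proof (induction k arbitrary: P)
  case 0
  then show ?case
    by (auto intro!: continuous_at_imp_continuous_on DERIV_isCont has_derivative_poly_exp_inv)
next
  case (Suc k)
  then show ?case using has_derivative_poly_exp_inv by auto
qed

definition exp_inv :: "real \<Rightarrow> real" where
  "exp_inv x = (if x > 0 then exp (- (1 / x)) else 0)"

lemma Ck_real_exp_inv: "Ck_real_on k UNIV exp_inv"
proof -
  have *: "exp_inv = poly_exp_inv 1" by (auto simp: exp_inv_def poly_exp_inv_def)
  show ?thesis unfolding * by (rule Ck_real_poly_exp_inv)
qed

lemma zero_derivative_sequence_open:
  fixes D :: "nat \<Rightarrow> real \<Rightarrow> real"
  assumes D: "\<And>k x. (D k has_real_derivative D (Suc k) x) (at x)"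
    and "open U" and "\<And>x. x \<in> U \<Longrightarrow> D 0 x = 0" and "x \<in> U"
  shows "D k x = 0"
  using \<open>x \<in> U\<close>
proof (induction k arbitrary: x)
  case 0
  then show ?case using assms by simp
next
  case (Suc k)
  have "(D k has_real_derivative 0) (at x)"
    by (rule has_field_derivative_transform_within_open[OF DERIV_const[of 0] \<open>open U\<close> Suc.prems])
      (simp add: Suc.IH)
  with D show ?case by (blast intro: DERIV_unique)
qed

lemma smooth_bump_exists:
  obtains b :: "nat \<Rightarrow> real \<Rightarrow> real" and M :: "nat \<Rightarrow> real" where
    "\<And>k x. (b k has_real_derivative b (Suc k) x) (at x)"
    "\<And>k x. \<bar>b k x\<bar> \<le> M k"
    "\<And>x. b 0 x \<ge> 0" "\<And>x. b 0 x > 0 \<longleftrightarrow> \<bar>x\<bar> < 1"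
proof -
  define f where "f x = exp_inv (1 * x + 1) * exp_inv ((-1) * x + 1)" for x
  have "Ck_real_on k UNIV f" for k
    unfolding f_def by (intro Ck_real_on_mult Ck_real_on_affine Ck_real_exp_inv)
  then obtain b where b: "b 0 = f" "\<And>k x. (b k has_real_derivative b (Suc k) x) (at x)"
    using Ck_real_derivative_sequence by metis
  have "\<exists>M. \<forall>x. \<bar>b k x\<bar> \<le> M" for k
  proof -
    have z: "b k x = 0" if "x \<in> - {-1..1}" for x
    proof (rule zero_derivative_sequence_open[where D = b, OF b(2) _ _ that])
      show "b 0 x = 0" if "x \<in> - {-1..1}" for x
        using that by (auto simp: b(1) f_def exp_inv_def)
    qed auto
    have "compact (b k ` {-1..1})"
      by (intro compact_continuous_image continuous_at_imp_continuous_on ballI DERIV_isCont[OF b(2)] compact_Icc)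
    then obtain M where "\<forall>y \<in> b k ` {-1..1}. norm y \<le> M"
      using compact_imp_bounded bounded_iff by blast
    then have "\<bar>b k x\<bar> \<le> max M 0" for x
      using z[of x] by (cases "x \<in> {-1..1}") force+
    then show ?thesis by blast
  qed
  then obtain M where "\<And>k x. \<bar>b k x\<bar> \<le> M k" by metis
  moreover have "b 0 x \<ge> 0" "b 0 x > 0 \<longleftrightarrow> \<bar>x\<bar> < 1" for x
    by (auto simp: b(1) f_def exp_inv_def)
  ultimately show thesis using b(2) that by blast
qed

lemma smooth_function_positive_on_open:
  fixes U :: "real set"
  assumes "open U"
  obtains D :: "nat \<Rightarrow> real \<Rightarrow> real" where
    "\<And>k x. (D k has_real_derivative D (Suc k) x) (at x)"
    "\<And>x. D 0 x \<ge> 0" "\<And>x. D 0 x > 0 \<longleftrightarrow> x \<in> U"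
proof -
  obtain b M where b: "\<And>k x. (b k has_real_derivative b (Suc k) x) (at x)"
    "\<And>k x. \<bar>b k x\<bar> \<le> M k" "\<And>x. b 0 x \<ge> 0" "\<And>x. b 0 x > 0 \<longleftrightarrow> \<bar>x\<bar> < (1::real)"
    using smooth_bump_exists by metis
  define q :: "nat \<Rightarrow> real" where "q n = from_nat_into \<rat> (fst (prod_decode n))" for n
  define r :: "nat \<Rightarrow> real" where "r n = 1 / real (Suc (snd (prod_decode n)))" for n
  \<comment> \<open>The factor \<open>r n ^ n\<close> beats the factor \<open>1 / r n ^ k\<close> of the \<open>k\<close>-th derivative as soon as \<open>n \<ge> k\<close>.\<close>
  define c where "c n = (if ball (q n) (r n) \<subseteq> U then (r n / 2) ^ n else 0)" for n
  define f where "f k n x = c n * (1 / r n) ^ k * b k ((1 / r n) * x + (- q n / r n))" for k n x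
  define D where "D k x = (\<Sum>n. f k n x)" for k x
  have r: "0 < r n" "r n \<le> 1" for n by (auto simp: r_def)
  have c: "0 \<le> c n" "c n \<le> (r n / 2) ^ n" for n using r[of n] by (auto simp: c_def)
  have df: "(f k n has_real_derivative f (Suc k) n x) (at x)" for k n x
  proof -
    have "((\<lambda>x. b k ((1 / r n) * x + (- q n / r n))) has_real_derivative
       b (Suc k) ((1 / r n) * x + (- q n / r n)) * (1 / r n)) (at x)"
      by (rule DERIV_chain2[OF b(1)]) (use r[of n] in \<open>auto intro!: derivative_eq_intros\<close>)
    from DERIV_cmult[OF this, of "c n * (1 / r n) ^ k"] show ?thesis
      by (simp add: f_def[abs_def] mult_ac)
  qed
  have f_bound: "norm (f k n x) \<le> M k * (1/2) ^ n" if "k \<le> n" for k n x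
  proof -
    have "c n * (1 / r n) ^ k \<le> (r n / 2) ^ n * (1 / r n) ^ k"
      using c r[of n] by (intro mult_right_mono) auto
    also have "\<dots> = (1/2) ^ n * r n ^ (n - k)"
      using r[of n] that by (simp add: power_divide field_simps power_diff)
    also have "\<dots> \<le> (1/2) ^ n * 1"
      using r[of n] by (intro mult_left_mono power_le_one) auto
    finally have "c n * (1 / r n) ^ k \<le> (1/2) ^ n" by simp
    then have "(c n * (1 / r n) ^ k) * \<bar>b k ((1 / r n) * x + (- q n / r n))\<bar> \<le> (1/2) ^ n * M k"
      using c r[of n] b(2) by (intro mult_mono) auto
    then show ?thesis
      using c[of n] r[of n] by (simp add: f_def abs_mult power_abs mult_ac)
  qed
  have sm: "summable (\<lambda>n. M k * (1/2) ^ n)" for k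
    by (intro summable_mult summable_geometric) auto
  have ev: "\<forall>\<^sub>F n in sequentially. \<forall>x\<in>UNIV. norm (f k n x) \<le> M k * (1/2) ^ n" for k
    using eventually_ge_at_top[of k] by eventually_elim (blast intro: f_bound)
  have sf: "summable (\<lambda>n. f k n x)" for k x
    by (rule summable_comparison_test_ev[OF _ sm[of k]]) (use ev[of k] in \<open>auto elim: eventually_mono\<close>)
  have "(D k has_real_derivative D (Suc k) x) (at x)" for k x
  proof -
    have "uniformly_convergent_on UNIV (\<lambda>n x. \<Sum>i<n. f (Suc k) i x)"
      by (rule Weierstrass_m_test'_ev[OF ev sm])
    then show ?thesis
      using has_field_derivative_series'(2)[of UNIV "f k" "f (Suc k)" 0 x] df sf
      by (simp add: D_def[abs_def])
  qed
  moreover have f0: "f 0 n x \<ge> 0" for n x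
    using c b by (simp add: f_def)
  then have "D 0 x \<ge> 0" for x
    unfolding D_def by (intro suminf_nonneg sf)
  moreover have "D 0 x > 0 \<longleftrightarrow> x \<in> U" for x
  proof
    assume "x \<in> U"
    then obtain e where e: "e > 0" "ball x e \<subseteq> U"
      using \<open>open U\<close> open_contains_ball by blast
    obtain m where m: "1 / real (Suc m) < e / 2"
      using e(1) nat_approx_posE[of "e/2"] by auto
    obtain p where p: "p \<in> \<rat>" "x - 1 / real (Suc m) < p" "p < x + 1 / real (Suc m)"
      using Rats_dense_in_real[of "x - 1 / real (Suc m)" "x + 1 / real (Suc m)"] by (auto simp: field_simps)
    obtain i where i: "from_nat_into \<rat> i = p"
      using p(1) countable_rat from_nat_into_surj by metis
    define n where "n = prod_encode (i, m)"
    have n: "q n = p" "r n = 1 / real (Suc m)" by (auto simp: q_def r_def n_def i)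
    have "ball (q n) (r n) \<subseteq> ball x e"
      using p m n by (auto simp: dist_real_def)
    with e have "c n > 0" using r[of n] by (simp add: c_def)
    moreover have "\<bar>(1 / r n) * x + (- q n / r n)\<bar> < 1"
    proof -
      have "(1 / r n) * x + (- q n / r n) = (x - q n) / r n" by (simp add: diff_divide_distrib)
      also have "\<bar>\<dots>\<bar> < 1"
      proof -
        have "\<bar>x - q n\<bar> < r n" unfolding n abs_less_iff using p by linarith
        then show ?thesis using r[of n] by (simp add: abs_divide)
      qed
      finally show ?thesis .
    qed
    ultimately have "f 0 n x > 0" using b(4) by (simp add: f_def)
    then show "D 0 x > 0" unfolding D_def by (intro suminf_pos2[OF sf f0])
  next
    assume *: "D 0 x > 0"
    show "x \<in> U"
    proof (rule ccontr)
      assume "x \<notin> U"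
      have "f 0 n x = 0" for n
      proof (cases "ball (q n) (r n) \<subseteq> U")
        case True
        with \<open>x \<notin> U\<close> have "x \<notin> ball (q n) (r n)" by blast
        then have "\<bar>q n - x\<bar> \<ge> r n" by (simp add: dist_real_def)
        have "(1 / r n) * x + (- q n / r n) = (x - q n) / r n" by (simp add: diff_divide_distrib)
        also have "\<bar>\<dots>\<bar> \<ge> 1" using \<open>\<bar>q n - x\<bar> \<ge> r n\<close> r[of n] by (simp add: abs_divide abs_minus_commute)
        finally have "\<not> b 0 ((1 / r n) * x + (- q n / r n)) > 0" using b(4) by simp
        then show ?thesis using b(3)[of "(1 / r n) * x + (- q n / r n)"] by (simp add: f_def)
      qed (simp add: f_def c_def)
      with * show False by (simp add: D_def)
    qed
  qed
  ultimately show thesis using that by blast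
qed

section \<open>Cauchy integrals up to the boundary\<close>

abbreviation closed_uhp :: "complex set" where
  "closed_uhp \<equiv> {z. 0 \<le> Im z}"

text \<open>The second and third primitives of \<open>1 / z\<close> on the closed upper half plane. With the third one
  the Cauchy integral of a smooth density becomes \<open>\<integral> f'''(t) K(z - t) dt\<close>, whose kernel is
  \<open>C\<^sup>1\<close> up to the boundary, so it can be differentiated under the integral on the real axis as well.\<close>

definition cauchy_kernel2 :: "complex \<Rightarrow> complex" where
  "cauchy_kernel2 z = z * Ln (- \<i> * z) - z"

definition cauchy_kernel3 :: "complex \<Rightarrow> complex" where
  "cauchy_kernel3 z = z\<^sup>2 / 2 * Ln (- \<i> * z) - 3 / 4 * z\<^sup>2"

lemma closed_uhp_not_nonpos:
  assumes "0 \<le> Im z" "z \<noteq> 0"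
  shows "- \<i> * z \<notin> \<real>\<^sub>\<le>\<^sub>0"
  using assms by (auto simp: complex_nonpos_Reals_iff complex_eq_iff)

lemma tendsto_mult_Ln_zero: "((\<lambda>z. z * Ln (- \<i> * z)) \<longlongrightarrow> 0) (at 0)"
proof (rule Lim_null_comparison)
  have "norm (z * Ln (- \<i> * z)) \<le> 2 * sqrt (norm z) + pi * norm z" if "z \<noteq> 0" "norm z < 1" for z
  proof -
    have w: "- \<i> * z \<noteq> 0" using that by simp
    have "norm (Ln (- \<i> * z)) \<le> \<bar>Re (Ln (- \<i> * z))\<bar> + \<bar>Im (Ln (- \<i> * z))\<bar>"
      by (rule cmod_le)
    also have "\<bar>Im (Ln (- \<i> * z))\<bar> \<le> pi"
      using mpi_less_Im_Ln[OF w] Im_Ln_le_pi[OF w] by (simp add: abs_le_iff)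
    also have "\<bar>Re (Ln (- \<i> * z))\<bar> = - ln (norm z)"
      using that w by (simp add: norm_mult)
    also have "- ln (norm z) \<le> 2 / sqrt (norm z)"
    proof -
      have "- ln (norm z) = 2 * ln (1 / sqrt (norm z))"
        using that by (simp add: ln_div ln_sqrt)
      also have "\<dots> \<le> 2 * (1 / sqrt (norm z))"
        using ln_bound[of "1 / sqrt (norm z)"] that by (intro mult_left_mono) auto
      finally show ?thesis by simp
    qed
    finally have "norm (Ln (- \<i> * z)) \<le> 2 / sqrt (norm z) + pi" by simp
    then have "norm z * norm (Ln (- \<i> * z)) \<le> norm z * (2 / sqrt (norm z) + pi)"
      by (intro mult_left_mono) auto
    also have "norm z * (2 / sqrt (norm z) + pi) = 2 * sqrt (norm z) + pi * norm z"
      using that real_div_sqrt[of "norm z"] by (simp add: field_simps)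
    finally show ?thesis by (simp add: norm_mult)
  qed
  then show "\<forall>\<^sub>F z in at 0. norm (z * Ln (- \<i> * z)) \<le> 2 * sqrt (norm z) + pi * norm z"
    unfolding eventually_at by (intro exI[of _ 1]) auto
  have "((\<lambda>z::complex. 2 * sqrt (norm z) + pi * norm z) \<longlongrightarrow> 2 * sqrt (norm (0::complex)) + pi * norm (0::complex)) (at 0)"
    by (intro tendsto_intros)
  then show "((\<lambda>z::complex. 2 * sqrt (norm z) + pi * norm z) \<longlongrightarrow> 0) (at 0)" by simp
qed

lemma continuous_on_cauchy_kernel2: "continuous_on closed_uhp cauchy_kernel2"
proof (unfold continuous_on_eq_continuous_within, intro ballI)
  fix z assume z: "z \<in> closed_uhp"
  show "continuous (at z within closed_uhp) cauchy_kernel2"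
  proof (cases "z = 0")
    case True
    have "((\<lambda>z. z * Ln (- \<i> * z) - z) \<longlongrightarrow> 0 - 0) (at 0 within closed_uhp)"
      by (intro tendsto_intros tendsto_within_subset[OF tendsto_mult_Ln_zero]) auto
    then show ?thesis
      using True by (simp add: continuous_within cauchy_kernel2_def[abs_def])
  next
    case False
    then have "isCont (\<lambda>z. z * Ln (- \<i> * z) - z) z"
      using closed_uhp_not_nonpos[of z] z by (intro continuous_intros) auto
    then show ?thesis
      unfolding cauchy_kernel2_def[abs_def] by (rule continuous_at_imp_continuous_at_within)
  qed
qed

lemma has_field_derivative_cauchy_kernel3:
  assumes "z \<in> closed_uhp"
  shows "(cauchy_kernel3 has_field_derivative cauchy_kernel2 z) (at z within closed_uhp)"
proof (cases "z = 0")
  case True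
  have "((\<lambda>z. z * Ln (- \<i> * z) / 2 - 3 / 4 * z) \<longlongrightarrow> 0 / 2 - 3 / 4 * 0) (at 0 within closed_uhp)"
    by (intro tendsto_intros tendsto_within_subset[OF tendsto_mult_Ln_zero]) auto
  then have "((\<lambda>z. z * Ln (- \<i> * z) / 2 - 3 / 4 * z) \<longlongrightarrow> 0) (at 0 within closed_uhp)"
    by simp
  then have "((\<lambda>y. (cauchy_kernel3 y - cauchy_kernel3 0) / (y - 0)) \<longlongrightarrow> 0) (at 0 within closed_uhp)"
    by (rule Lim_transform_eventually)
      (auto simp: eventually_at_filter cauchy_kernel3_def field_simps power2_eq_square)
  then show ?thesis
    using True by (simp add: has_field_derivative_iff cauchy_kernel2_def)
next
  case False
  then show ?thesis
    using closed_uhp_not_nonpos[of z] assms unfolding cauchy_kernel3_def[abs_def] cauchy_kernel2_def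
    by (auto intro!: derivative_eq_intros simp: field_simps power2_eq_square)
qed

lemma continuous_on_cauchy_kernel3: "continuous_on closed_uhp cauchy_kernel3"
  using has_field_derivative_cauchy_kernel3 DERIV_continuous_on by blast

lemma Im_cauchy_kernel3_of_real: "Im (cauchy_kernel3 (of_real x)) = - (pi / 4) * (x * \<bar>x\<bar>)"
proof -
  consider "x = 0" | "x > 0" | "x < 0" by linarith
  then show ?thesis
  proof cases
    case 2
    have "Ln (- \<i> * of_real x) = of_real (ln x) - \<i> * (of_real pi / 2)"
      using Ln_times_of_real[of x "- \<i>"] 2 by (simp add: mult.commute Ln_of_real)
    then show ?thesis
      using 2 unfolding cauchy_kernel3_def by (simp add: power2_eq_square)
  next
    case 3
    have "Ln (- \<i> * of_real x) = of_real (ln (- x)) + \<i> * (of_real pi / 2)"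
      using Ln_times_of_real[of "- x" "\<i>"] Ln_of_real[of "- x"] 3 by (simp add: mult.commute)
    then show ?thesis
      using 3 unfolding cauchy_kernel3_def by (simp add: power2_eq_square)
  qed (simp add: cauchy_kernel3_def)
qed

definition kernel_transform :: "real \<Rightarrow> (real \<Rightarrow> real) \<Rightarrow> complex \<Rightarrow> complex" where
  "kernel_transform A f z = integral {-A..A} (\<lambda>t. of_real (f t) * cauchy_kernel3 (z - of_real t))"

lemma has_field_derivative_kernel_transform:
  assumes f: "\<And>t. (f has_real_derivative f' t) (at t)" and f': "continuous_on UNIV f'"
    and A: "0 < A" "f A = 0" "f (- A) = 0" and z: "z \<in> closed_uhp"
  shows "(kernel_transform A f has_field_derivative kernel_transform A f' z) (at z within closed_uhp)"
proof -
  have cf: "continuous_on S f" for S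
    using f by (auto intro!: continuous_at_imp_continuous_on DERIV_isCont)
  have cf': "continuous_on S f'" for S
    using f' continuous_on_subset by blast
  have c3: "continuous_on S (\<lambda>t. cauchy_kernel3 (z - of_real t))" if "z \<in> closed_uhp" for S z
    by (rule continuous_on_compose2[OF continuous_on_cauchy_kernel3]) (use that in \<open>auto intro!: continuous_intros\<close>)
  have c2: "continuous_on S (\<lambda>t. cauchy_kernel2 (z - of_real t))" if "z \<in> closed_uhp" for S z
    by (rule continuous_on_compose2[OF continuous_on_cauchy_kernel2]) (use that in \<open>auto intro!: continuous_intros\<close>)
  have dk: "((\<lambda>z. cauchy_kernel3 (z - of_real t)) has_field_derivative cauchy_kernel2 (z - of_real t))
      (at z within closed_uhp)" if "z \<in> closed_uhp" for z t
  proof -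
    have "(cauchy_kernel3 has_field_derivative cauchy_kernel2 (z - of_real t))
       (at (z - of_real t) within (\<lambda>z. z - of_real t) ` closed_uhp)"
      by (rule DERIV_subset[OF has_field_derivative_cauchy_kernel3]) (use that in auto)
    moreover have "((\<lambda>z. z - complex_of_real t) has_field_derivative 1) (at z within closed_uhp)"
      by (auto intro!: derivative_eq_intros)
    ultimately show ?thesis
      using DERIV_image_chain[of cauchy_kernel3 _ "\<lambda>z. z - of_real t" z closed_uhp 1] by (simp add: o_def)
  qed
  have "((\<lambda>x. integral (cbox (-A) A) (\<lambda>t. of_real (f t) * cauchy_kernel3 (x - of_real t)))
      has_field_derivative integral (cbox (-A) A) (\<lambda>t. of_real (f t) * cauchy_kernel2 (z - of_real t)))
      (at z within closed_uhp)"
  proof (rule leibniz_rule_field_derivative[OF _ _ _ z])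
    show "((\<lambda>x. of_real (f t) * cauchy_kernel3 (x - of_real t)) has_field_derivative
       of_real (f t) * cauchy_kernel2 (x - of_real t)) (at x within closed_uhp)"
      if "x \<in> closed_uhp" for x t
      using DERIV_cmult[OF dk[OF that]] by simp
    show "(\<lambda>t. of_real (f t) * cauchy_kernel3 (x - of_real t)) integrable_on cbox (-A) A"
      if "x \<in> closed_uhp" for x
      using c3[OF that] cf by (intro integrable_continuous continuous_intros) auto
    have "continuous_on (closed_uhp \<times> cbox (-A) A) (\<lambda>p. complex_of_real (f (snd p)))"
      by (intro continuous_on_of_real continuous_on_compose2[OF cf[of UNIV]] continuous_on_snd continuous_on_id) auto
    moreover have "continuous_on (closed_uhp \<times> cbox (-A) A) (\<lambda>p. cauchy_kernel2 (fst p - of_real (snd p)))"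
      by (rule continuous_on_compose2[OF continuous_on_cauchy_kernel2]) (auto intro!: continuous_intros)
    ultimately show "continuous_on (closed_uhp \<times> cbox (-A) A)
       (\<lambda>(x, t). of_real (f t) * cauchy_kernel2 (x - of_real t))"
      unfolding split_def by (intro continuous_on_mult)
    show "convex closed_uhp"
      by (simp add: convex_halfspace_Im_ge)
  qed
  moreover have "integral (cbox (-A) A) (\<lambda>t. of_real (f t) * cauchy_kernel2 (z - of_real t)) =
     integral {-A..A} (\<lambda>t. of_real (f' t) * cauchy_kernel3 (z - of_real t))"
  proof -
    have "((\<lambda>t. of_real (f t) * cauchy_kernel3 (z - of_real t)) has_vector_derivative
       of_real (f' t) * cauchy_kernel3 (z - of_real t) - of_real (f t) * cauchy_kernel2 (z - of_real t))
       (at t within {-A..A})" for t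
    proof -
      have "((\<lambda>t. of_real (f t)) has_vector_derivative complex_of_real (f' t)) (at t within {-A..A})"
        using f[of t] has_vector_derivative_of_real has_real_derivative_iff_has_vector_derivative
          has_vector_derivative_at_within by blast
      moreover have "((\<lambda>t. cauchy_kernel3 (z - of_real t)) has_vector_derivative
         - cauchy_kernel2 (z - of_real t)) (at t within {-A..A})"
      proof -
        have "((\<lambda>t. z - of_real t) has_vector_derivative -1) (at t within {-A..A})"
          by (auto intro!: derivative_eq_intros)
        moreover have "(cauchy_kernel3 has_field_derivative cauchy_kernel2 (z - of_real t))
           (at (z - of_real t) within (\<lambda>t. z - of_real t) ` {-A..A})"
          by (rule DERIV_subset[OF has_field_derivative_cauchy_kernel3]) (use z in auto)
        ultimately show ?thesis
          using field_vector_diff_chain_within[of "\<lambda>t. z - of_real t" "-1" t "{-A..A}" cauchy_kernel3]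
          by (simp add: o_def)
      qed
      ultimately have "((\<lambda>t. of_real (f t) * cauchy_kernel3 (z - of_real t)) has_vector_derivative
         of_real (f t) * - cauchy_kernel2 (z - of_real t) + of_real (f' t) * cauchy_kernel3 (z - of_real t))
         (at t within {-A..A})"
        by (rule has_vector_derivative_mult)
      then show ?thesis by (simp add: algebra_simps)
    qed
    then have "((\<lambda>t. of_real (f' t) * cauchy_kernel3 (z - of_real t) - of_real (f t) * cauchy_kernel2 (z - of_real t))
       has_integral (of_real (f A) * cauchy_kernel3 (z - of_real A) - of_real (f (-A)) * cauchy_kernel3 (z - of_real (-A)))) {-A..A}"
      by (intro fundamental_theorem_of_calculus) (use A in auto)
    then have "integral {-A..A} (\<lambda>t. of_real (f' t) * cauchy_kernel3 (z - of_real t) - of_real (f t) * cauchy_kernel2 (z - of_real t)) = 0"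
      using A by (simp add: integral_unique)
    moreover have "(\<lambda>t. of_real (f' t) * cauchy_kernel3 (z - of_real t)) integrable_on {-A..A}"
      "(\<lambda>t. of_real (f t) * cauchy_kernel2 (z - of_real t)) integrable_on {-A..A}"
      using c3[OF z] c2[OF z] cf cf' by (auto intro!: integrable_continuous_real continuous_intros)
    ultimately show ?thesis
      by (simp add: integral_diff)
  qed
  ultimately show ?thesis
    by (simp add: kernel_transform_def[abs_def])
qed

lemma integral_third_derivative_signed_square:
  fixes D :: "nat \<Rightarrow> real \<Rightarrow> real"
  assumes D: "\<And>k x. (D k has_real_derivative D (Suc k) x) (at x)"
    and D0: "\<And>k. D k A = 0" "\<And>k. D k (- A) = 0" and x: "- A \<le> x" "x \<le> A"
  shows "((\<lambda>t. D 3 t * ((x - t) * \<bar>x - t\<bar>)) has_integral 4 * D 0 x) {-A..A}"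
proof -
  define P where "P t = D 2 t * (x - t)\<^sup>2 + 2 * (x - t) * D 1 t + 2 * D 0 t" for t
  have P: "(P has_real_derivative D 3 t * (x - t)\<^sup>2) (at t within S)" for t S
  proof -
    have "(P has_real_derivative D 3 t * (x - t)\<^sup>2) (at t)"
      using D[of 0 t] D[of 1 t] D[of 2 t] unfolding P_def
      by (auto intro!: derivative_eq_intros simp: eval_nat_numeral algebra_simps)
    then show ?thesis by (rule DERIV_subset) auto
  qed
  have "((\<lambda>t. D 3 t * (x - t)\<^sup>2) has_integral (P x - P (- A))) {-A..x}"
    using P x(1) by (intro fundamental_theorem_of_calculus) (auto simp: has_real_derivative_iff_has_vector_derivative)
  then have 1: "((\<lambda>t. D 3 t * ((x - t) * \<bar>x - t\<bar>)) has_integral (P x - P (- A))) {-A..x}"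
    by (rule has_integral_eq[rotated]) (auto simp: power2_eq_square)
  have "((\<lambda>t. D 3 t * (x - t)\<^sup>2) has_integral (P A - P x)) {x..A}"
    using P x(2) by (intro fundamental_theorem_of_calculus) (auto simp: has_real_derivative_iff_has_vector_derivative)
  then have "((\<lambda>t. - (D 3 t * (x - t)\<^sup>2)) has_integral - (P A - P x)) {x..A}"
    by (rule has_integral_neg)
  then have 2: "((\<lambda>t. D 3 t * ((x - t) * \<bar>x - t\<bar>)) has_integral - (P A - P x)) {x..A}"
    by (rule has_integral_eq[rotated]) (auto simp: power2_eq_square algebra_simps)
  have "P x - P (- A) + - (P A - P x) = 4 * D 0 x"
    by (simp add: P_def D0)
  with has_integral_combine[OF x 1 2] show ?thesis by simp
qed

lemma Im_kernel_transform_third_derivative: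
  fixes D :: "nat \<Rightarrow> real \<Rightarrow> real"
  assumes D: "\<And>k x. (D k has_real_derivative D (Suc k) x) (at x)"
    and D0: "\<And>k. D k A = 0" "\<And>k. D k (- A) = 0" and x: "- A \<le> x" "x \<le> A"
  shows "Im (kernel_transform A (D 3) (of_real x)) = - pi * D 0 x"
proof -
  have "continuous_on {-A..A} (\<lambda>t. cauchy_kernel3 (of_real x - of_real t))"
    by (rule continuous_on_compose2[OF continuous_on_cauchy_kernel3]) (auto intro!: continuous_intros)
  moreover have "continuous_on {-A..A} (D 3)"
    using D by (auto intro!: continuous_at_imp_continuous_on DERIV_isCont)
  ultimately have "(\<lambda>t. of_real (D 3 t) * cauchy_kernel3 (of_real x - of_real t)) integrable_on {-A..A}"
    by (intro integrable_continuous_real continuous_intros)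
  then have "((\<lambda>t. of_real (D 3 t) * cauchy_kernel3 (of_real x - of_real t)) has_integral
      kernel_transform A (D 3) (of_real x)) {-A..A}"
    unfolding kernel_transform_def by (rule integrable_integral)
  from has_integral_linear[OF this bounded_linear_Im]
  have "((\<lambda>t. D 3 t * (- (pi / 4) * ((x - t) * \<bar>x - t\<bar>))) has_integral
      Im (kernel_transform A (D 3) (of_real x))) {-A..A}"
    using Im_cauchy_kernel3_of_real[of "x - _"] by (simp add: o_def)
  moreover have "((\<lambda>t. D 3 t * (- (pi / 4) * ((x - t) * \<bar>x - t\<bar>))) has_integral - (pi / 4) * (4 * D 0 x)) {-A..A}"
    using has_integral_mult_right[OF integral_third_derivative_signed_square[where D = D, OF D D0 x], of "- (pi/4)"]
    by (simp add: mult_ac)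
  ultimately have "Im (kernel_transform A (D 3) (of_real x)) = - (pi / 4) * (4 * D 0 x)"
    by (rule has_integral_unique)
  then show ?thesis by simp
qed

abbreviation half_box :: "complex set" where
  "half_box \<equiv> {z. \<bar>Re z\<bar> \<le> 2 \<and> 0 \<le> Im z \<and> Im z \<le> 2}"

lemma half_box_eq_cbox: "half_box = cbox (Complex (-2) 0) (Complex 2 2)"
  by (auto simp: in_cbox_complex_iff)

lemma compact_half_box: "compact half_box"
  by (simp add: half_box_eq_cbox)

lemma convex_half_box: "convex half_box"
  by (simp add: half_box_eq_cbox)

lemma smooth_holomorphic_with_boundary_zeros:
  fixes F :: "real set"
  assumes "closed F"
  obtains H :: "nat \<Rightarrow> complex \<Rightarrow> complex" where
    "\<And>k z. z \<in> closed_uhp \<Longrightarrow> (H k has_field_derivative H (Suc k) z) (at z within closed_uhp)"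
    "\<And>x. \<bar>x\<bar> \<le> 2 \<Longrightarrow> 0 \<le> Im (H 0 (of_real x))"
    "\<And>x. \<bar>x\<bar> \<le> 2 \<Longrightarrow> Im (H 0 (of_real x)) = 0 \<longleftrightarrow> x \<in> F"
    "\<And>z. z \<in> half_box \<Longrightarrow> norm (H 0 z) \<le> 1 / 4"
    "\<And>z. z \<in> half_box \<Longrightarrow> norm (H 1 z) \<le> 1 / 4"
proof -
  have "open ({-3<..<3} - F)" using assms by auto
  then obtain D where D: "\<And>k x. (D k has_real_derivative D (Suc k) x) (at x)"
    "\<And>x. D 0 x \<ge> (0::real)" "\<And>x. D 0 x > 0 \<longleftrightarrow> x \<in> {-3<..<3} - F"
    using smooth_function_positive_on_open by metis
  have D0: "D k x = 0" if "x \<in> - {-3..3}" for k x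
  proof (rule zero_derivative_sequence_open[where D = D, OF D(1) _ _ that])
    show "D 0 x = 0" if "x \<in> - {-3..3}" for x
      using that D(2)[of x] D(3)[of x] by auto
  qed auto
  have cD: "continuous_on UNIV (D k)" for k
    using D(1) by (auto intro!: continuous_at_imp_continuous_on DERIV_isCont)
  define T where "T k = kernel_transform 4 (D (k + 3))" for k
  have T: "(T k has_field_derivative T (Suc k) z) (at z within closed_uhp)" if "z \<in> closed_uhp" for k z
    unfolding T_def
  proof (rule has_field_derivative_kernel_transform)
    show "(D (k + 3) has_real_derivative D (Suc k + 3) t) (at t)" for t
      using D(1)[of "k + 3"] by simp
  qed (use cD D0 that in auto)
  have "\<exists>B>0. \<forall>z\<in>half_box. norm (T k z) \<le> B" for k
  proof -
    have "continuous_on half_box (T k)"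
      using DERIV_continuous_on[OF T] by (rule continuous_on_subset) auto
    then have "bounded (T k ` half_box)"
      by (intro compact_imp_bounded compact_continuous_image compact_half_box)
    then show ?thesis by (auto simp: bounded_pos)
  qed
  then obtain B where B: "\<And>k. B k > 0" "\<And>k z. z \<in> half_box \<Longrightarrow> norm (T k z) \<le> B k"
    by metis
  define e where "e = 1 / (4 * (B 0 + B 1))"
  have e: "e > 0" using B(1)[of 0] B(1)[of 1] by (simp add: e_def)
  have eB: "e * B 0 \<le> 1 / 4" "e * B 1 \<le> 1 / 4"
    using B(1)[of 0] B(1)[of 1] by (simp_all add: e_def field_simps)
  define H where "H k z = - of_real e * T k z" for k z
  have small: "norm (H k z) \<le> e * B k" if "z \<in> half_box" for k z
    using B(2)[OF that] e by (simp add: H_def norm_mult)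
  have Im: "Im (H 0 (of_real x)) = e * pi * D 0 x" if "\<bar>x\<bar> \<le> 2" for x
  proof -
    have "Im (T 0 (of_real x)) = - pi * D 0 x"
      unfolding T_def add_0
      by (rule Im_kernel_transform_third_derivative[where D = D, OF D(1)]) (use that D0 in auto)
    then show ?thesis by (simp add: H_def)
  qed
  show thesis
  proof
    show "(H k has_field_derivative H (Suc k) z) (at z within closed_uhp)" if "z \<in> closed_uhp" for k z
      unfolding H_def by (rule DERIV_cmult[OF T[OF that]])
    show "0 \<le> Im (H 0 (of_real x))" if "\<bar>x\<bar> \<le> 2" for x
      using Im[OF that] e D(2) by simp
    show "Im (H 0 (of_real x)) = 0 \<longleftrightarrow> x \<in> F" if "\<bar>x\<bar> \<le> 2" for x
      using Im[OF that] e D(2)[of x] D(3)[of x] that by auto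
    show "norm (H 0 z) \<le> 1 / 4" "norm (H 1 z) \<le> 1 / 4" if "z \<in> half_box" for z
      using small[OF that, of 0] small[OF that, of 1] eB by linarith+
  qed
qed

section \<open>Non-analyticity and extension of graphs\<close>

lemma not_real_analytic_add_exp_inv:
  fixes A :: "real \<Rightarrow> real"
  shows "\<not> real_analytic_on B1 (\<lambda>p. A (fst p) + exp_inv (snd p - 1 / 2))"
proof
  assume an: "real_analytic_on B1 (\<lambda>p. A (fst p) + exp_inv (snd p - 1 / 2))"
  have "(0, 1/2) \<in> B1" by (simp add: B1_def dist_prod_def)
  with an obtain r a where r: "r > 0" and a: "\<And>x. x \<in> ball (0, 1/2) r \<Longrightarrow>
      ((\<lambda>(i,j). a i j * (fst x - fst (0::real, 1/2::real)) ^ i * (snd x - snd (0::real, 1/2::real)) ^ j)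
        has_sum (A (fst x) + exp_inv (snd x - 1 / 2))) UNIV"
    unfolding real_analytic_on_def by blast
  have sums: "(\<lambda>j. a 0 j * s ^ j) sums (A 0 + exp_inv s)" if "\<bar>s\<bar> < r" for s
  proof -
    have "((\<lambda>(i,j). a i j * 0 ^ i * s ^ j) has_sum (A 0 + exp_inv s)) UNIV"
      using a[of "(0, 1/2 + s)"] that by (simp add: dist_prod_def dist_real_def)
    moreover have "((\<lambda>(i,j). a i j * 0 ^ i * s ^ j) has_sum (A 0 + exp_inv s)) UNIV
        \<longleftrightarrow> ((\<lambda>(i,j). a i j * 0 ^ i * s ^ j) has_sum (A 0 + exp_inv s)) (Pair 0 ` UNIV)"
      by (rule has_sum_cong_neutral) (auto simp: power_0_left)
    ultimately have "((\<lambda>(i,j). a i j * 0 ^ i * s ^ j) has_sum (A 0 + exp_inv s)) (Pair 0 ` UNIV)"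
      by simp
    then have "((\<lambda>j. a 0 j * s ^ j) has_sum (A 0 + exp_inv s)) UNIV"
      by (subst (asm) has_sum_reindex) (auto simp: inj_on_def o_def)
    then show ?thesis by (rule has_sum_imp_sums)
  qed
  define c where "c = (\<lambda>j. if j = 0 then a 0 0 - A 0 else a 0 j)"
  have c: "(\<lambda>j. c j * (s - 0) ^ j) sums exp_inv s" if "norm (s - 0) < r" for s
  proof -
    have "(\<lambda>j. a 0 j * s ^ j - (if j = 0 then A 0 else 0)) sums (A 0 + exp_inv s - A 0)"
      using sums_diff[OF sums sums_single[of 0 "\<lambda>_. A 0"]] that by simp
    moreover have "(\<lambda>j. a 0 j * s ^ j - (if j = 0 then A 0 else 0)) = (\<lambda>j. c j * (s - 0) ^ j)"
      by (auto simp: c_def)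
    ultimately show ?thesis by simp
  qed
  have "c m = 0" if m: "m > 0" for m
  proof (rule ccontr)
    assume "c m \<noteq> 0"
    then obtain s where s: "0 < s" "\<And>z. z \<in> cball 0 s - {0} \<Longrightarrow> exp_inv z \<noteq> 0"
      using powser_0_nonzero[OF r c _ _ m] by (auto simp: exp_inv_def)
    have "- s \<in> cball 0 s - {0}" using s(1) by auto
    from s(2)[OF this] s(1) show False by (simp add: exp_inv_def)
  qed
  moreover have "c 0 = 0"
    using sums_unique2[OF _ powser_sums_zero[of c]] c[of 0] r by (fastforce simp: exp_inv_def)
  ultimately have "c j = 0" for j by (cases "j = 0") auto
  then have "exp_inv (r / 2) = 0"
    using c[of "r / 2"] r sums_unique2[OF _ sums_zero] by fastforce
  then show False using r by (simp add: exp_inv_def)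
qed

lemma C1alpha_real_extension:
  assumes "Ck_real_on 2 S g" "{-1..1} \<subseteq> S"
  obtains G where "C1alpha_real (1/2) G" "\<And>x. x \<in> {-1..1} \<Longrightarrow> G x = g x"
proof -
  obtain g' g'' where g': "\<And>x. x \<in> S \<Longrightarrow> (g has_real_derivative g' x) (at x)"
    and g'': "\<And>x. x \<in> S \<Longrightarrow> (g' has_real_derivative g'' x) (at x)" and cg'': "continuous_on S g''"
    using assms(1) by (auto simp: numeral_2_eq_2)
  obtain B where B: "B > 0" "\<And>x. x \<in> {-1..1} \<Longrightarrow> \<bar>g'' x\<bar> \<le> B"
  proof -
    have "compact (g'' ` {-1..1})"
      using cg'' assms(2) by (intro compact_continuous_image continuous_on_subset[OF cg''] compact_Icc)
    then show thesis using compact_imp_bounded that by (fastforce simp: bounded_pos)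
  qed
  have lip: "\<bar>g' x - g' y\<bar> \<le> B * \<bar>x - y\<bar>" if "x \<in> {-1..1}" "y \<in> {-1..1}" for x y
  proof -
    have "norm (g' x - g' y) \<le> B * norm (x - y)"
      by (rule field_differentiable_bound[of "{-1..1}" g' g''])
        (use that assms(2) B in \<open>auto intro!: has_field_derivative_at_within[OF g'']\<close>)
    then show ?thesis by simp
  qed
  define cl :: "real \<Rightarrow> real" where "cl t = max (-1) (min 1 t)" for t
  have cl: "cl t \<in> {-1..1}" "\<bar>cl s - cl t\<bar> \<le> \<bar>s - t\<bar>" "\<bar>cl s - cl t\<bar> \<le> 2" for s t
    by (auto simp: cl_def)
  define k where "k t = g' (cl t)" for t
  have hol: "\<bar>k s - k t\<bar> \<le> 2 * B * \<bar>s - t\<bar> powr (1/2)" for s t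
  proof -
    have 1: "\<bar>k s - k t\<bar> \<le> B * \<bar>cl s - cl t\<bar>"
      unfolding k_def by (rule lip[OF cl(1) cl(1)])
    also have "\<bar>cl s - cl t\<bar> \<le> 2 * \<bar>s - t\<bar> powr (1/2)"
    proof (cases "\<bar>s - t\<bar> \<le> 1")
      case True
      have "\<bar>s - t\<bar> \<le> \<bar>s - t\<bar> powr (1/2)"
        using powr_mono'[of "1/2" 1 "\<bar>s - t\<bar>"] True by simp
      then show ?thesis using cl(2)[of s t] powr_ge_zero[of "\<bar>s - t\<bar>" "1/2"] by linarith
    next
      case False
      then have "1 \<le> \<bar>s - t\<bar> powr (1/2)" by (intro ge_one_powr_ge_zero) auto
      then show ?thesis using cl(3)[of s t] by linarith
    qed
    finally show ?thesis using B(1) by (simp add: mult_ac)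
  qed
  have "isCont k t" for t
  proof -
    have "continuous_on UNIV cl" unfolding cl_def by (intro continuous_intros)
    moreover have "continuous_on {-1..1} g'"
      using assms(2) by (auto intro!: continuous_at_imp_continuous_on DERIV_isCont[OF g''])
    ultimately have "continuous_on UNIV k"
      unfolding k_def using cl(1) by (intro continuous_on_compose2[of "{-1..1}" g' UNIV cl]) auto
    then show ?thesis by (simp add: continuous_on_eq_continuous_at)
  qed
  then obtain P where P: "\<And>x. (P has_vector_derivative k x) (at x)"
    using einterval_antiderivative[of "-\<infinity>" \<infinity> k] by auto
  have "(\<lambda>x. P x - g x) constant_on {-1..1}"
  proof -
    have "\<exists>c. \<forall>x\<in>{-1..1}. P x - g x = c"
    proof (rule has_field_derivative_zero_constant)
      fix x :: real assume x: "x \<in> {-1..1}"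
      have "(P has_real_derivative g' x) (at x within {-1..1})"
        using has_vector_derivative_at_within[OF P[of x]] x
        by (auto simp: k_def cl_def has_real_derivative_iff_has_vector_derivative)
      moreover have "(g has_real_derivative g' x) (at x within {-1..1})"
        using g' x assms(2) has_field_derivative_at_within by blast
      ultimately show "((\<lambda>x. P x - g x) has_real_derivative 0) (at x within {-1..1})"
        using DERIV_diff by fastforce
    qed simp
    then show ?thesis by (auto simp: constant_on_def)
  qed
  then obtain c where c: "\<And>x. x \<in> {-1..1} \<Longrightarrow> P x - g x = c"
    by (auto simp: constant_on_def)
  show thesis
  proof
    have "((\<lambda>x. P x - c) has_real_derivative k x) (at x)" for x
      using P[of x] by (auto intro!: derivative_eq_intros simp: has_real_derivative_iff_has_vector_derivative[symmetric])
    then show "C1alpha_real (1/2) (\<lambda>x. P x - c)"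
      unfolding C1alpha_real_def using hol by blast
    show "P x - c = g x" if "x \<in> {-1..1}" for x using c[OF that] by simp
  qed
qed

lemma C1alpha_real_reflect:
  assumes "C1alpha_real \<alpha> G"
  shows "C1alpha_real \<alpha> (\<lambda>s. G (a - s) - c)"
proof -
  obtain G' C where G': "\<And>t. (G has_real_derivative G' t) (at t)"
    and C: "\<And>s t. \<bar>G' s - G' t\<bar> \<le> C * \<bar>s - t\<bar> powr \<alpha>"
    using assms unfolding C1alpha_real_def by blast
  have "((\<lambda>s. G (a - s) - c) has_real_derivative - G' (a - t)) (at t)" for t
    by (auto intro!: derivative_eq_intros DERIV_chain2[OF G'])
  moreover have "\<bar>- G' (a - s) - (- G' (a - t))\<bar> \<le> C * \<bar>s - t\<bar> powr \<alpha>" for s t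
    using C[of "a - t" "a - s"] by simp
  ultimately show ?thesis
    unfolding C1alpha_real_def by (intro exI[of _ "\<lambda>s. - G' (a - s)"] conjI) blast+
qed

section \<open>The two-phase solution\<close>

lemma cmod_Complex_diff: "cmod (Complex a b - Complex c d) = dist (a, b) (c, d)"
  by (simp add: dist_prod_def dist_real_def cmod_def)

lemma B1_bounds:
  assumes "p \<in> B1"
  shows "\<bar>fst p\<bar> < 1 \<and> \<bar>snd p\<bar> < 1 \<and> \<bar>fst p\<bar> \<le> 2 \<and> snd p < 1 \<and> snd p \<le> 2"
proof -
  have "\<bar>fst p\<bar> < 1" "\<bar>snd p\<bar> < 1"
    using assms dist_fst_le[of "(0,0)" p] dist_snd_le[of "(0,0)" p]
    by (auto simp: B1_def dist_real_def)
  then show ?thesis by linarith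
qed

lemma open_B1: "open B1"
  by (simp add: B1_def)

lemma mem_B1_iff: "(x, y) \<in> B1 \<longleftrightarrow> x\<^sup>2 + y\<^sup>2 < 1"
  by (simp add: B1_def dist_prod_def dist_real_def)

lemma exp_inv_nonneg: "exp_inv x \<ge> 0"
  by (simp add: exp_inv_def)

locale boundary_perturbation =
  fixes F :: "real set" and H :: "nat \<Rightarrow> complex \<Rightarrow> complex"
  assumes H: "\<And>k z. z \<in> closed_uhp \<Longrightarrow> (H k has_field_derivative H (Suc k) z) (at z within closed_uhp)"
    and Im_H_nonneg: "\<And>x. \<bar>x\<bar> \<le> 2 \<Longrightarrow> 0 \<le> Im (H 0 (of_real x))"
    and Im_H_zero: "\<And>x. \<bar>x\<bar> \<le> 2 \<Longrightarrow> Im (H 0 (of_real x)) = 0 \<longleftrightarrow> x \<in> F"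
    and H0_le: "\<And>z. z \<in> half_box \<Longrightarrow> norm (H 0 z) \<le> 1 / 4"
    and H1_le: "\<And>z. z \<in> half_box \<Longrightarrow> norm (H 1 z) \<le> 1 / 4"
begin

text \<open>Extending by the boundary values to \<open>y < 0\<close> makes \<open>v\<close> negative there.\<close>

definition w :: "real \<Rightarrow> real \<Rightarrow> real" where
  "w x y = Im (H 0 (Complex x (max y 0)))"

definition v :: "R2 \<Rightarrow> real" where
  "v p = snd p - w (fst p) (snd p)"

lemma H_lipschitz:
  assumes "\<And>z. z \<in> half_box \<Longrightarrow> norm (H (Suc k) z) \<le> B" "z \<in> half_box" "z' \<in> half_box"
  shows "norm (H k z - H k z') \<le> B * norm (z - z')"
  by (rule field_differentiable_bound[OF convex_half_box _ assms])
    (auto intro!: DERIV_subset[OF H])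

lemma w_lipschitz:
  assumes "\<bar>x\<bar> \<le> 2" "\<bar>x'\<bar> \<le> 2" "y \<le> 2" "y' \<le> 2"
  shows "\<bar>w x y - w x' y'\<bar> \<le> (\<bar>x - x'\<bar> + \<bar>y - y'\<bar>) / 4"
proof -
  let ?z = "Complex x (max y 0)" and ?z' = "Complex x' (max y' 0)"
  have "\<bar>w x y - w x' y'\<bar> \<le> norm (H 0 ?z - H 0 ?z')"
    unfolding w_def using abs_Im_le_cmod[of "H 0 ?z - H 0 ?z'"] by simp
  also have "\<dots> \<le> 1 / 4 * norm (?z - ?z')"
    by (rule H_lipschitz) (use H1_le assms in auto)
  also have "norm (?z - ?z') \<le> \<bar>x - x'\<bar> + \<bar>y - y'\<bar>"
    using cmod_le[of "?z - ?z'"] by (simp add: max_def split: if_splits)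
  finally show ?thesis by simp
qed

lemma v_increasing:
  assumes "\<bar>x\<bar> \<le> 2" "y \<le> y'" "y' \<le> 2"
  shows "v (x, y') - v (x, y) \<ge> 3 / 4 * (y' - y)"
  proof -
  have "\<bar>w x y' - w x y\<bar> \<le> (y' - y) / 4"
    using w_lipschitz[of x x y' y] assms by simp
  from abs_le_D1[OF this] show ?thesis by (simp add: v_def field_simps)
qed

lemma v_continuous: "continuous_on ({-2..2} \<times> {..2}) v"
proof -
  have "continuous_on ({-2..2} \<times> {..2}) (\<lambda>p. H 0 (Complex (fst p) (max (snd p) 0)))"
    by (rule continuous_on_compose2[OF DERIV_continuous_on[OF H[of _ 0]]])
      (auto simp: Complex_eq intro!: continuous_intros)
  then show ?thesis
    unfolding v_def[abs_def] w_def by (intro continuous_intros)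
qed

lemma free_boundary_exists:
  assumes "\<bar>x\<bar> \<le> 2"
  shows "\<exists>y. 0 \<le> y \<and> y \<le> 1 / 4 \<and> v (x, y) = 0"
proof -
  have "v (x, 0) \<le> 0"
    using Im_H_nonneg[OF assms] by (simp add: v_def w_def complex_of_real_def)
  moreover have "v (x, 1) \<ge> 0"
    using H0_le[of "Complex x 1"] abs_Im_le_cmod[of "H 0 (Complex x 1)"] assms
    by (simp add: v_def w_def)
  moreover have "continuous_on {0..1} (\<lambda>y. v (x, y))"
    by (rule continuous_on_compose2[OF v_continuous]) (use assms in \<open>auto intro!: continuous_intros\<close>)
  ultimately obtain y where y: "0 \<le> y" "y \<le> 1" "v (x, y) = 0"
    using IVT'[of "\<lambda>y. v (x, y)" 0 0 1] by auto
  have "y \<le> 1 / 4"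
    using y H0_le[of "Complex x y"] abs_Im_le_cmod[of "H 0 (Complex x y)"] assms
    by (simp add: v_def w_def)
  with y show ?thesis by blast
qed

definition g :: "real \<Rightarrow> real" where
  "g x = (SOME y. 0 \<le> y \<and> y \<le> 1 / 4 \<and> v (x, y) = 0)"

lemma g: assumes "\<bar>x\<bar> \<le> 2" shows "0 \<le> g x" "g x \<le> 1 / 4" "v (x, g x) = 0"
  using someI_ex[OF free_boundary_exists[OF assms]] unfolding g_def by auto

lemma v_sign:
  assumes "\<bar>x\<bar> \<le> 2" "y \<le> 2"
  shows "v (x, y) > 0 \<longleftrightarrow> y > g x" "v (x, y) = 0 \<longleftrightarrow> y = g x"
proof -
  have g': "g x \<le> 2" "v (x, g x) = 0" using g[OF assms(1)] by auto
  have *: "v (x, a) < v (x, b)" if "a < b" "b \<le> 2" for a b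
    using v_increasing[OF assms(1), of a b] that by auto
  show "v (x, y) > 0 \<longleftrightarrow> y > g x" "v (x, y) = 0 \<longleftrightarrow> y = g x"
    using *[of y "g x"] *[of "g x" y] g' assms(2) by (cases y "g x" rule: linorder_cases; simp)+
qed

lemma g_eq_w: "\<bar>x\<bar> \<le> 2 \<Longrightarrow> g x = Im (H 0 (Complex x (g x)))"
  using g[of x] by (simp add: v_def w_def)

lemma g_eq_0_iff: "\<bar>x\<bar> \<le> 2 \<Longrightarrow> g x = 0 \<longleftrightarrow> x \<in> F"
  using v_sign(2)[of x 0] Im_H_zero[of x] by (auto simp: v_def w_def complex_of_real_def)

lemma g_lipschitz:
  assumes "\<bar>x\<bar> \<le> 2" "\<bar>x'\<bar> \<le> 2"
  shows "\<bar>g x - g x'\<bar> \<le> \<bar>x - x'\<bar> / 3"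
proof -
  have "g x = w x (g x)" "g x' = w x' (g x')"
    using g[OF assms(1)] g[OF assms(2)] by (simp_all add: v_def)
  moreover have "\<bar>w x (g x) - w x' (g x')\<bar> \<le> (\<bar>x - x'\<bar> + \<bar>g x - g x'\<bar>) / 4"
    using g(2)[OF assms(1)] g(2)[OF assms(2)] assms by (intro w_lipschitz) auto
  ultimately show ?thesis by simp
qed

definition \<zeta> :: "real \<Rightarrow> complex" where
  "\<zeta> x = Complex x (g x)"

lemma \<zeta>_in: "\<bar>x\<bar> \<le> 2 \<Longrightarrow> \<zeta> x \<in> half_box" "\<bar>x\<bar> \<le> 2 \<Longrightarrow> \<zeta> x \<in> closed_uhp"
  using g[of x] by (auto simp: \<zeta>_def)

lemma Re_H1_le:
  assumes "z \<in> half_box" shows "1 - Re (H 1 z) \<ge> 3 / 4"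
  using H1_le[OF assms] abs_Re_le_cmod[of "H 1 z"] by linarith

text \<open>Implicit differentiation of \<open>g x = Im (H 0 (x + \<i> g x))\<close>.\<close>

definition slope :: "real \<Rightarrow> real" where
  "slope x = Im (H 1 (\<zeta> x)) * inverse (1 - Re (H 1 (\<zeta> x)))"

lemma has_derivative_g:
  assumes "\<bar>x\<bar> < 2"
  shows "(g has_real_derivative slope x) (at x)"
  unfolding has_field_derivative_def has_derivative_at_alt
proof (intro conjI allI impI)
  show "bounded_linear ((*) (slope x))" by (rule bounded_linear_mult_right)
  fix e :: real assume "e > 0"
  define a where "a = 1 - Re (H 1 (\<zeta> x))"
  have a: "a \<ge> 3 / 4" unfolding a_def using Re_H1_le \<zeta>_in assms by simp
  have "(H 0 has_derivative (*) (H 1 (\<zeta> x))) (at (\<zeta> x) within closed_uhp)"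
    using H[of "\<zeta> x" 0] \<zeta>_in assms by (simp add: has_field_derivative_def)
  then obtain d where d: "d > 0" "\<And>z. z \<in> closed_uhp \<Longrightarrow> norm (z - \<zeta> x) < d \<Longrightarrow>
     norm (H 0 z - H 0 (\<zeta> x) - H 1 (\<zeta> x) * (z - \<zeta> x)) \<le> e / 3 * norm (z - \<zeta> x)"
    unfolding has_derivative_within_alt using \<open>e > 0\<close> zero_less_divide_iff[of e 3] by fastforce
  have "norm (g y - g x - slope x * (y - x)) \<le> e * norm (y - x)"
    if y: "norm (y - x) < min (d / 2) (2 - \<bar>x\<bar>)" for y
  proof -
    have y2: "\<bar>y\<bar> \<le> 2" using y by auto
    have "norm (\<zeta> y - \<zeta> x) \<le> \<bar>y - x\<bar> + \<bar>g y - g x\<bar>"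
      using cmod_le[of "\<zeta> y - \<zeta> x"] by (simp add: \<zeta>_def)
    also have "\<bar>g y - g x\<bar> \<le> \<bar>y - x\<bar>" 
    proof -
      have "\<bar>g y - g x\<bar> \<le> \<bar>y - x\<bar> / 3" using g_lipschitz[OF y2, of x] assms by simp
      also have "\<dots> \<le> \<bar>y - x\<bar>" by simp
      finally show ?thesis .
    qed
    finally have n: "norm (\<zeta> y - \<zeta> x) \<le> 2 * \<bar>y - x\<bar>" by simp
    define R where "R = H 0 (\<zeta> y) - H 0 (\<zeta> x) - H 1 (\<zeta> x) * (\<zeta> y - \<zeta> x)"
    have "norm R \<le> e / 3 * norm (\<zeta> y - \<zeta> x)"
      unfolding R_def by (rule d(2)) (use \<zeta>_in y2 n y in auto)
    also have "\<dots> \<le> e / 3 * (2 * \<bar>y - x\<bar>)"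
      using \<open>e > 0\<close> n by (intro mult_left_mono) auto
    finally have R: "\<bar>Im R\<bar> \<le> 2 / 3 * e * \<bar>y - x\<bar>"
      using abs_Im_le_cmod[of R] by (simp add: mult_ac)
    have "Im R = g y - g x - (Im (H 1 (\<zeta> x)) * (y - x) + Re (H 1 (\<zeta> x)) * (g y - g x))"
      using g_eq_w[OF y2] g_eq_w[of x] assms unfolding R_def \<zeta>_def by simp
    also have "\<dots> = a * (g y - g x - slope x * (y - x))"
      using a unfolding slope_def a_def by (simp add: field_simps)
    finally have "a * \<bar>g y - g x - slope x * (y - x)\<bar> \<le> 2 / 3 * e * \<bar>y - x\<bar>"
      using R a by (simp add: abs_mult)
    moreover have "3 / 4 * \<bar>g y - g x - slope x * (y - x)\<bar> \<le> a * \<bar>g y - g x - slope x * (y - x)\<bar>"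
      using a by (intro mult_right_mono) auto
    moreover have "2 / 3 * e * \<bar>y - x\<bar> \<le> 3 / 4 * (e * \<bar>y - x\<bar>)"
      using \<open>e > 0\<close> by simp
    ultimately show ?thesis by simp
  qed
  then show "\<exists>d>0. \<forall>y. norm (y - x) < d \<longrightarrow> norm (g y - g x - slope x * (y - x)) \<le> e * norm (y - x)"
    using d(1) assms by (intro exI[of _ "min (d / 2) (2 - \<bar>x\<bar>)"]) auto
qed

lemma has_derivative_H_\<zeta>:
  assumes "\<bar>x\<bar> < 2"
  shows "((\<lambda>x. H j (\<zeta> x)) has_vector_derivative Complex 1 (slope x) * H (Suc j) (\<zeta> x)) (at x)"
proof -
  let ?I = "{-2<..<2::real}"
  have "(\<zeta> has_vector_derivative Complex 1 (slope x)) (at x)"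
  proof -
    have "((\<lambda>x. of_real x + \<i> * of_real (g x)) has_vector_derivative (of_real 1 + \<i> * of_real (slope x))) (at x)"
      using has_derivative_g[OF assms]
      by (intro has_vector_derivative_add has_vector_derivative_mult_right has_vector_derivative_of_real)
        (auto simp: has_real_derivative_iff_has_vector_derivative)
    then show ?thesis by (simp add: \<zeta>_def[abs_def] Complex_eq)
  qed
  then have "(\<zeta> has_vector_derivative Complex 1 (slope x)) (at x within ?I)"
    by (rule has_vector_derivative_at_within)
  moreover have "(H j has_field_derivative H (Suc j) (\<zeta> x)) (at (\<zeta> x) within \<zeta> ` ?I)"
    using assms \<zeta>_in(2) by (intro DERIV_subset[OF H]) auto
  ultimately have "(H j \<circ> \<zeta> has_vector_derivative Complex 1 (slope x) * H (Suc j) (\<zeta> x)) (at x within ?I)"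
    by (rule field_vector_diff_chain_within)
  moreover have "at x within ?I = at x"
    using assms by (intro at_within_open) auto
  ultimately show ?thesis by (simp add: o_def)
qed

lemma Ck_real_on_g:
  "Ck_real_on k {-2<..<2} g \<and> (\<forall>j. Ck_real_on k {-2<..<2} (\<lambda>x. Re (H j (\<zeta> x))) \<and>
     Ck_real_on k {-2<..<2} (\<lambda>x. Im (H j (\<zeta> x))))"
proof (induction k)
  case 0
  have "continuous_on {-2<..<2} g"
    by (auto intro!: continuous_at_imp_continuous_on DERIV_isCont[OF has_derivative_g])
  moreover have "continuous_on {-2<..<2} (\<lambda>x. H j (\<zeta> x))" for j
    by (auto intro!: continuous_at_imp_continuous_on has_vector_derivative_continuous[OF has_derivative_H_\<zeta>])
  ultimately show ?case by (auto intro: continuous_intros)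
next
  case (Suc k)
  let ?I = "{-2<..<2::real}"
  note [simp del] = One_nat_def
  have slope: "Ck_real_on k ?I slope"
    unfolding slope_def
  proof (intro Ck_real_on_mult Ck_real_on_inverse)
    show "Ck_real_on k ?I (\<lambda>x. Im (H 1 (\<zeta> x)))" using Suc by blast
    show "1 - Re (H 1 (\<zeta> x)) \<noteq> 0" if "x \<in> ?I" for x
      using Re_H1_le[of "\<zeta> x"] \<zeta>_in(1)[of x] that by force
    show "Ck_real_on k ?I (\<lambda>x. 1 - Re (H 1 (\<zeta> x)))"
      using Ck_real_on_add[OF Ck_real_on_const Ck_real_on_minus, of k ?I "\<lambda>x. Re (H 1 (\<zeta> x))" 1] Suc by simp
  qed
  have "Ck_real_on (Suc k) ?I g"
    using slope has_derivative_g by (auto intro!: exI[of _ slope])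
  moreover have "Ck_real_on (Suc k) ?I (\<lambda>x. Re (H j (\<zeta> x)))" for j
  proof -
    have "((\<lambda>x. Re (H j (\<zeta> x))) has_real_derivative
        Re (H (Suc j) (\<zeta> x)) + - (slope x * Im (H (Suc j) (\<zeta> x)))) (at x)" if "x \<in> ?I" for x
      using bounded_linear.has_vector_derivative[OF bounded_linear_Re has_derivative_H_\<zeta>[of x j]] that
      by (auto simp: has_real_derivative_iff_has_vector_derivative)
    moreover have "Ck_real_on k ?I (\<lambda>x. Re (H (Suc j) (\<zeta> x)) + - (slope x * Im (H (Suc j) (\<zeta> x))))"
      using Suc slope by (intro Ck_real_on_add Ck_real_on_minus Ck_real_on_mult) auto
    ultimately show ?thesis
      unfolding Ck_real_on.simps by (intro exI conjI ballI)
  qed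
  moreover have "Ck_real_on (Suc k) ?I (\<lambda>x. Im (H j (\<zeta> x)))" for j
  proof -
    have "((\<lambda>x. Im (H j (\<zeta> x))) has_real_derivative
        Im (H (Suc j) (\<zeta> x)) + slope x * Re (H (Suc j) (\<zeta> x))) (at x)" if "x \<in> ?I" for x
      using bounded_linear.has_vector_derivative[OF bounded_linear_Im has_derivative_H_\<zeta>[of x j]] that
      by (auto simp: has_real_derivative_iff_has_vector_derivative)
    moreover have "Ck_real_on k ?I (\<lambda>x. Im (H (Suc j) (\<zeta> x)) + slope x * Re (H (Suc j) (\<zeta> x)))"
      using Suc slope by (intro Ck_real_on_add Ck_real_on_mult) auto
    ultimately show ?thesis
      unfolding Ck_real_on.simps by (intro exI conjI ballI)
  qed
  ultimately show ?case by blast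
qed

definition grad_sq :: "real \<Rightarrow> real" where
  "grad_sq x = (norm (1 - H 1 (\<zeta> x)))\<^sup>2"

lemma Ck_real_on_grad_sq: "Ck_real_on k {-2<..<2} grad_sq"
proof -
  let ?I = "{-2<..<2::real}"
  have "grad_sq = (\<lambda>x. (1 + - Re (H 1 (\<zeta> x))) * (1 + - Re (H 1 (\<zeta> x))) + Im (H 1 (\<zeta> x)) * Im (H 1 (\<zeta> x)))"
    by (auto simp: grad_sq_def cmod_power2 simp flip: power2_eq_square)
  moreover have "Ck_real_on k ?I (\<lambda>x. (1 + - Re (H 1 (\<zeta> x))) * (1 + - Re (H 1 (\<zeta> x))) + Im (H 1 (\<zeta> x)) * Im (H 1 (\<zeta> x)))"
    using Ck_real_on_g[of k] by (intro Ck_real_on_add Ck_real_on_minus Ck_real_on_mult Ck_real_on_const) auto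
  ultimately show ?thesis by (simp only:)
qed

lemma grad_sq_pos: "\<bar>x\<bar> \<le> 2 \<Longrightarrow> grad_sq x > 0"
  using Re_H1_le[OF \<zeta>_in(1), of x] by (force simp: grad_sq_def)

definition u :: "R2 \<Rightarrow> real" where
  "u p = max (v p) 0 + min (snd p) 0"

lemma v_neg: "\<bar>fst p\<bar> \<le> 2 \<Longrightarrow> snd p < 0 \<Longrightarrow> v p < 0"
  using v_sign[of "fst p" "snd p"] g[of "fst p"] by (cases p) (auto simp: not_less linorder_neq_iff)

lemma Omega_plus_u: "Omega_plus u = {p \<in> B1. v p > 0}"
proof -
  have "u p > 0 \<longleftrightarrow> v p > 0" if "p \<in> B1" for p
    using v_neg[of p] B1_bounds[OF that] by (cases "snd p < 0") (auto simp: u_def)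
  then show ?thesis by (auto simp: Omega_plus_def)
qed

lemma Omega_minus_u: "Omega_minus u = {p \<in> B1. snd p < 0}"
proof -
  have "u p < 0 \<longleftrightarrow> snd p < 0" if "p \<in> B1" for p
    using v_neg[of p] B1_bounds[OF that] by (cases "snd p < 0") (auto simp: u_def)
  then show ?thesis by (auto simp: Omega_minus_def)
qed

lemma pos_part_u: "p \<in> B1 \<Longrightarrow> pos_part u p = max (v p) 0"
  using v_neg[of p] B1_bounds[of p] by (cases "snd p < 0") (auto simp: u_def pos_part_def)

lemma neg_part_u: "p \<in> B1 \<Longrightarrow> neg_part u p = max (- snd p) 0"
  using v_neg[of p] B1_bounds[of p] by (cases "snd p < 0") (auto simp: u_def neg_part_def)

lemma continuous_on_v_B1: "continuous_on B1 v"
  by (rule continuous_on_subset[OF v_continuous]) (use B1_bounds in force)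

lemma u_lipschitz: "3-lipschitz_on B1 u"
proof (rule lipschitz_onI)
  fix p q assume pq: "p \<in> B1" "q \<in> B1"
  have d: "\<bar>fst p - fst q\<bar> \<le> dist p q" "\<bar>snd p - snd q\<bar> \<le> dist p q"
    using dist_fst_le[of p q] dist_snd_le[of p q] by (auto simp: dist_real_def)
  have "\<bar>w (fst p) (snd p) - w (fst q) (snd q)\<bar> \<le> (\<bar>fst p - fst q\<bar> + \<bar>snd p - snd q\<bar>) / 4"
    using B1_bounds[OF pq(1)] B1_bounds[OF pq(2)] by (intro w_lipschitz) auto
  moreover have "\<bar>v p - v q\<bar> \<le> \<bar>snd p - snd q\<bar> + \<bar>w (fst p) (snd p) - w (fst q) (snd q)\<bar>"
    unfolding v_def using abs_triangle_ineq4[of "snd p - snd q" "w (fst p) (snd p) - w (fst q) (snd q)"]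
    by (simp add: algebra_simps)
  ultimately have "\<bar>v p - v q\<bar> \<le> 3 / 2 * dist p q"
    using d by simp
  moreover have "\<bar>max (v p) 0 - max (v q) 0\<bar> \<le> \<bar>v p - v q\<bar>" by auto
  moreover have "\<bar>min (snd p) 0 - min (snd q) 0\<bar> \<le> dist p q" using d(2) by auto
  ultimately have "\<bar>max (v p) 0 - max (v q) 0\<bar> + \<bar>min (snd p) 0 - min (snd q) 0\<bar> \<le> 3 / 2 * dist p q + dist p q"
    by (intro add_mono) (rule order_trans)
  also have "\<dots> \<le> 3 * dist p q" by simp
  finally show "dist (u p) (u q) \<le> 3 * dist p q"
    using abs_triangle_ineq[of "max (v p) 0 - max (v q) 0" "min (snd p) 0 - min (snd q) 0"]
    by (simp add: u_def dist_real_def algebra_simps)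
qed simp

lemma open_Omega_plus: "open (Omega_plus u)"
proof -
  have "Omega_plus u = B1 \<inter> v -` {0<..}" by (auto simp: Omega_plus_u)
  then show ?thesis
    using continuous_open_preimage[OF continuous_on_v_B1 open_B1] by (metis open_greaterThan)
qed

lemma open_Omega_minus: "open (Omega_minus u)"
proof -
  have "Omega_minus u = B1 \<inter> snd -` {..<0}" by (auto simp: Omega_minus_u)
  then show ?thesis
    using open_B1 by (simp add: open_Int open_vimage_snd)
qed

lemma closure_Omega_plus: "closure (Omega_plus u) \<subseteq> {p. \<bar>fst p\<bar> \<le> 1 \<and> \<bar>snd p\<bar> \<le> 1 \<and> v p \<ge> 0}"
proof (rule closure_minimal)
  show "Omega_plus u \<subseteq> {p. \<bar>fst p\<bar> \<le> 1 \<and> \<bar>snd p\<bar> \<le> 1 \<and> v p \<ge> 0}"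
    using B1_bounds by (force simp: Omega_plus_u)
  have "continuous_on ({-1..1} \<times> {-1..1}) v"
    by (rule continuous_on_subset[OF v_continuous]) auto
  then have "closed (({-1..1} \<times> {-1..1}) \<inter> v -` {0..})"
    by (intro continuous_closed_preimage closed_Times) auto
  moreover have "({-1..1} \<times> {-1..1}) \<inter> v -` {0..} = {p. \<bar>fst p\<bar> \<le> 1 \<and> \<bar>snd p\<bar> \<le> 1 \<and> v p \<ge> 0}"
    by auto
  ultimately show "closed {p. \<bar>fst p\<bar> \<le> 1 \<and> \<bar>snd p\<bar> \<le> 1 \<and> v p \<ge> 0}" by simp
qed

lemma closure_Omega_minus: "closure (Omega_minus u) \<subseteq> {p. snd p \<le> 0}"
proof (rule closure_minimal)
  show "Omega_minus u \<subseteq> {p. snd p \<le> 0}" by (auto simp: Omega_minus_u)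
  have "{p::R2. snd p \<le> 0} = snd -` {..0}" by auto
  then show "closed {p::R2. snd p \<le> 0}" by (simp add: closed_vimage_snd)
qed

lemma frontier_Omega_plus:
  assumes "p \<in> frontier (Omega_plus u)" "p \<in> B1"
  shows "v p = 0" "snd p = g (fst p)"
proof -
  have "p \<in> closure (Omega_plus u)" "p \<notin> Omega_plus u"
    using assms(1) open_Omega_plus by (auto simp: frontier_def interior_open)
  then show "v p = 0" using closure_Omega_plus assms(2) by (force simp: Omega_plus_u)
  then show "snd p = g (fst p)"
    using v_sign(2)[of "fst p" "snd p"] B1_bounds[OF assms(2)] by simp
qed

lemma frontier_Omega_minus:
  assumes "p \<in> frontier (Omega_minus u)" "p \<in> B1"
  shows "snd p = 0"
proof -
  have "p \<in> closure (Omega_minus u)" "p \<notin> Omega_minus u"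
    using assms(1) open_Omega_minus by (auto simp: frontier_def interior_open)
  then show ?thesis using closure_Omega_minus assms(2) by (force simp: Omega_minus_u)
qed

lemma C1alpha_boundary_Omega_plus: "C1alpha_boundary (1/2) B1 (Omega_plus u)"
  unfolding C1alpha_boundary_def
proof
  obtain G where G: "C1alpha_real (1/2) G" "\<And>x. x \<in> {-1..1} \<Longrightarrow> G x = g x"
  proof (rule C1alpha_real_extension)
    show "Ck_real_on 2 {-2<..<2} g" using Ck_real_on_g by blast
  qed auto
  fix p assume p: "p \<in> frontier (Omega_plus u) \<inter> B1"
  then obtain r where r: "r > 0" "ball p r \<subseteq> B1"
    using open_B1 open_contains_ball by blast
  have "x \<in> Omega_plus u \<longleftrightarrow>
      (x - p) \<bullet> (0, 1) > G (fst p - (x - p) \<bullet> (- snd (0, 1), fst (0, 1))) - snd p" if "x \<in> ball p r" for x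
  proof -
    have x: "x \<in> B1" using that r by auto
    have "x \<in> Omega_plus u \<longleftrightarrow> snd x > g (fst x)"
      using v_sign(1)[of "fst x" "snd x"] x B1_bounds[OF x] by (auto simp: Omega_plus_u)
    moreover have "G (fst x) = g (fst x)"
      using B1_bounds[OF x] by (intro G(2)) (auto simp: abs_less_iff)
    ultimately show ?thesis by (simp add: inner_prod_def)
  qed
  then show "\<exists>r>0. \<exists>e g. norm e = 1 \<and> C1alpha_real (1 / 2) g \<and>
      (\<forall>x\<in>ball p r. (x \<in> Omega_plus u) = (g ((x - p) \<bullet> (- snd e, fst e)) < (x - p) \<bullet> e))"
    using r(1) C1alpha_real_reflect[OF G(1), of "fst p" "snd p"]
    by (intro exI[of _ r] conjI exI[of _ "(0, 1)"] exI[of _ "\<lambda>s. G (fst p - s) - snd p"])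
      (auto simp: norm_Pair)
qed

lemma C1alpha_boundary_Omega_minus: "C1alpha_boundary (1/2) B1 (Omega_minus u)"
  unfolding C1alpha_boundary_def
proof
  fix p assume p: "p \<in> frontier (Omega_minus u) \<inter> B1"
  then obtain r where r: "r > 0" "ball p r \<subseteq> B1"
    using open_B1 open_contains_ball by blast
  have "x \<in> Omega_minus u \<longleftrightarrow> (x - p) \<bullet> (0, -1) > 0" if "x \<in> ball p r" for x
    using that r(2) frontier_Omega_minus[of p] p by (auto simp: Omega_minus_u inner_prod_def)
  moreover have "C1alpha_real (1/2) (\<lambda>s. 0)"
    unfolding C1alpha_real_def by (intro exI[of _ "\<lambda>s. 0"]) (auto intro!: exI[of _ 0])
  ultimately show "\<exists>r>0. \<exists>e g. norm e = 1 \<and> C1alpha_real (1 / 2) g \<and>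
      (\<forall>x\<in>ball p r. (x \<in> Omega_minus u) = (g ((x - p) \<bullet> (- snd e, fst e)) < (x - p) \<bullet> e))"
    using r(1) by (intro exI[of _ r] conjI exI[of _ "(0, -1)"] exI[of _ "\<lambda>s. 0"]) (auto simp: norm_Pair)
qed

definition Gp :: "R2 \<Rightarrow> R2" where
  "Gp p = (- Im (H 1 (Complex (fst p) (snd p))), 1 - Re (H 1 (Complex (fst p) (snd p))))"

lemma has_derivative_H_pair:
  assumes "snd p > 0"
  shows "((\<lambda>p. H j (Complex (fst p) (snd p))) has_derivative
     (\<lambda>h. H (Suc j) (Complex (fst p) (snd p)) * Complex (fst h) (snd h))) (at p)"
proof -
  let ?z = "Complex (fst p) (snd p)"
  have "?z \<in> interior closed_uhp"
    using assms open_halfspace_Im_gt[of 0] by (intro interiorI[of "{z. 0 < Im z}"]) auto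
  then have "(H j has_derivative (*) (H (Suc j) ?z)) (at ?z)"
    using H[of ?z j] assms at_within_interior[of ?z closed_uhp] by (simp add: has_field_derivative_def)
  moreover have "((\<lambda>p. Complex (fst p) (snd p)) has_derivative (\<lambda>h. Complex (fst h) (snd h))) (at p)"
    unfolding Complex_eq by (auto intro!: derivative_eq_intros)
  ultimately show ?thesis
    using has_derivative_compose by blast
qed

lemma Omega_plus_snd_pos: "p \<in> Omega_plus u \<Longrightarrow> snd p > 0"
  using v_sign(1)[of "fst p" "snd p"] g(1)[of "fst p"] B1_bounds[of p] by (auto simp: Omega_plus_u)

lemma pos_part_u_eq:
  assumes "p \<in> Omega_plus u" shows "pos_part u p = snd p - Im (H 0 (Complex (fst p) (snd p)))"
  using assms pos_part_u[of p] Omega_plus_snd_pos[OF assms] by (auto simp: Omega_plus_u v_def w_def)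

lemma has_derivative_pos_part_u:
  assumes "p \<in> Omega_plus u"
  shows "(pos_part u has_derivative (\<lambda>h. Gp p \<bullet> h)) (at p)"
proof -
  have "((\<lambda>p. snd p - Im (H 0 (Complex (fst p) (snd p)))) has_derivative
     (\<lambda>h. snd h - Im (H (Suc 0) (Complex (fst p) (snd p)) * Complex (fst h) (snd h)))) (at p)"
    by (intro has_derivative_diff has_derivative_snd has_derivative_ident has_derivative_Im
        has_derivative_H_pair Omega_plus_snd_pos assms)
  moreover have "(\<lambda>h. snd h - Im (H (Suc 0) (Complex (fst p) (snd p)) * Complex (fst h) (snd h))) = (\<lambda>h. Gp p \<bullet> h)"
    by (auto simp: Gp_def inner_prod_def algebra_simps)
  ultimately have "((\<lambda>p. snd p - Im (H 0 (Complex (fst p) (snd p)))) has_derivative (\<lambda>h. Gp p \<bullet> h)) (at p)"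
    by (simp only:)
  then show ?thesis
    by (rule has_derivative_transform_within_open[OF _ open_Omega_plus assms]) (simp add: pos_part_u_eq)
qed

lemma harmonic_pos_part_u: "harmonic_on (Omega_plus u) (pos_part u)"
proof -
  define Hs where "Hs p h = (- Im (H 2 (Complex (fst p) (snd p)) * Complex (fst h) (snd h)),
     - Re (H 2 (Complex (fst p) (snd p)) * Complex (fst h) (snd h)))" for p h :: R2
  have "(Gp has_derivative Hs p) (at p)" if "p \<in> Omega_plus u" for p
  proof -
    note d = has_derivative_H_pair[OF Omega_plus_snd_pos[OF that], of 1]
    have "((\<lambda>p. (- Im (H 1 (Complex (fst p) (snd p))), 1 - Re (H 1 (Complex (fst p) (snd p))))) has_derivative
       (\<lambda>h. (- Im (H (Suc 1) (Complex (fst p) (snd p)) * Complex (fst h) (snd h)),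
        0 - Re (H (Suc 1) (Complex (fst p) (snd p)) * Complex (fst h) (snd h))))) (at p)"
      by (intro has_derivative_Pair has_derivative_minus has_derivative_diff has_derivative_const
          has_derivative_Im has_derivative_Re d)
    then show ?thesis
      by (simp add: Gp_def[abs_def] Hs_def[abs_def] numeral_2_eq_2)
  qed
  moreover have "fst (Hs p (1,0)) + snd (Hs p (0,1)) = 0" for p
    by (simp add: Hs_def)
  moreover have "continuous_on (Omega_plus u) (\<lambda>p. Hs p h)" for h
  proof -
    have "continuous_on (Omega_plus u) (\<lambda>p. H 2 (Complex (fst p) (snd p)))"
      using has_derivative_H_pair[of _ 2] Omega_plus_snd_pos
      by (intro continuous_at_imp_continuous_on ballI) (blast intro: has_derivative_continuous)
    then show ?thesis unfolding Hs_def by (intro continuous_intros)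
  qed
  ultimately show ?thesis
    unfolding harmonic_on_def using has_derivative_pos_part_u
    by (intro exI[of _ Gp] exI[of _ Hs]) auto
qed

lemma has_derivative_neg_part_u:
  assumes "p \<in> Omega_minus u"
  shows "(neg_part u has_derivative (\<lambda>h. (0, -1) \<bullet> h)) (at p)"
proof -
  have "((\<lambda>p. - snd p) has_derivative (\<lambda>h. (0, -1) \<bullet> h)) (at p)"
    by (auto intro!: derivative_eq_intros simp: inner_prod_def)
  then show ?thesis
    by (rule has_derivative_transform_within_open[OF _ open_Omega_minus assms])
      (auto simp: neg_part_u Omega_minus_u)
qed

lemma harmonic_neg_part_u: "harmonic_on (Omega_minus u) (neg_part u)"
  unfolding harmonic_on_def using has_derivative_neg_part_u
  by (intro exI[of _ "\<lambda>p. (0, -1)"] exI[of _ "\<lambda>p h. 0"]) auto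

lemma interior_closure_Omega_plus: "interior (closure (Omega_plus u) \<inter> B1) \<subseteq> Omega_plus u"
proof
  fix p assume "p \<in> interior (closure (Omega_plus u) \<inter> B1)"
  then obtain e where e: "e > 0" "ball p e \<subseteq> closure (Omega_plus u) \<inter> B1"
    by (meson mem_interior)
  define q where "q = (fst p, snd p - e / 2)"
  have "q \<in> ball p e" using e(1) by (cases p) (auto simp: q_def dist_prod_def dist_real_def)
  with e have "v q \<ge> 0" using closure_Omega_plus by blast
  have p: "p \<in> B1" using e by auto
  have "v p > 0"
    using v_increasing[of "fst p" "snd p - e / 2" "snd p"] \<open>v q \<ge> 0\<close> B1_bounds[OF p] e(1)
    by (simp add: q_def)
  with p show "p \<in> Omega_plus u" by (simp add: Omega_plus_u)
qed

lemma interior_closure_Omega_minus: "interior (closure (Omega_minus u) \<inter> B1) \<subseteq> Omega_minus u"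
proof
  fix p assume "p \<in> interior (closure (Omega_minus u) \<inter> B1)"
  then obtain e where e: "e > 0" "ball p e \<subseteq> closure (Omega_minus u) \<inter> B1"
    by (meson mem_interior)
  define q where "q = (fst p, snd p + e / 2)"
  have "q \<in> ball p e" using e(1) by (cases p) (auto simp: q_def dist_prod_def dist_real_def)
  with e have "snd q \<le> 0" using closure_Omega_minus by blast
  moreover have "p \<in> B1" using e by auto
  ultimately show "p \<in> Omega_minus u" using e(1) by (simp add: Omega_minus_u q_def)
qed

lemma C1alpha_grad_pos_part_u: "C1alpha_grad (1/2) (closure (Omega_plus u) \<inter> B1) (pos_part u) Gp"
  unfolding C1alpha_grad_def
proof (intro conjI ballI)
  let ?S = "closure (Omega_plus u) \<inter> B1"
  have "continuous_on ?S (\<lambda>p. max (v p) 0)"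
    using continuous_on_subset[OF continuous_on_v_B1] by (intro continuous_intros) auto
  then show "continuous_on ?S (pos_part u)"
    by (subst continuous_on_cong[OF refl pos_part_u]) auto
  show "(pos_part u has_derivative (\<lambda>h. Gp p \<bullet> h)) (at p)" if "p \<in> interior ?S" for p
    using that interior_closure_Omega_plus has_derivative_pos_part_u by blast
  have "continuous_on half_box (H 2)"
    using DERIV_continuous_on[OF H[of _ 2]] by (rule continuous_on_subset) auto
  then have "bounded (H 2 ` half_box)"
    by (intro compact_imp_bounded compact_continuous_image compact_half_box)
  then obtain B where B: "B > 0" "\<And>z. z \<in> half_box \<Longrightarrow> norm (H (Suc 1) z) \<le> B"
    by (auto simp: bounded_pos numeral_2_eq_2)
  have in_box: "Complex (fst y) (snd y) \<in> half_box" if "y \<in> ?S" for y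
  proof -
    have "v y \<ge> 0" "\<bar>fst y\<bar> < 1" "\<bar>snd y\<bar> < 1"
      using that closure_Omega_plus B1_bounds by blast+
    moreover have "snd y \<ge> 0"
      using v_neg[of y] calculation by force
    ultimately show ?thesis by auto
  qed
  have lip: "norm (Gp y - Gp z) \<le> B * dist y z" if "y \<in> ?S" "z \<in> ?S" for y z
  proof -
    let ?a = "Complex (fst y) (snd y)" and ?b = "Complex (fst z) (snd z)"
    have "norm (Gp y - Gp z) = norm (H 1 ?a - H 1 ?b)"
      by (simp add: Gp_def norm_Pair cmod_def power2_commute add.commute)
    also have "\<dots> \<le> B * norm (?a - ?b)"
      by (rule H_lipschitz[OF B(2) in_box in_box]) (use that in auto)
    finally show ?thesis by (simp add: cmod_Complex_diff)
  qed
  show "\<exists>r>0. \<exists>C. \<forall>y\<in>?S \<inter> ball x r. \<forall>z\<in>?S \<inter> ball x r. norm (Gp y - Gp z) \<le> C * dist y z powr (1/2)" for x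
  proof (intro exI conjI ballI)
    fix y z assume yz: "y \<in> ?S \<inter> ball x (1/2)" "z \<in> ?S \<inter> ball x (1/2)"
    have "dist y z \<le> 1" using dist_triangle[of y z x] yz by (auto simp: dist_commute)
    then have "dist y z \<le> dist y z powr (1/2)"
      using powr_mono'[of "1/2" 1 "dist y z"] by simp
    then have "B * dist y z \<le> B * dist y z powr (1/2)"
      using B(1) by simp
    with lip[of y z] yz show "norm (Gp y - Gp z) \<le> B * dist y z powr (1/2)" by auto
  qed simp
qed

lemma C1alpha_grad_neg_part_u:
  "C1alpha_grad (1/2) (closure (Omega_minus u) \<inter> B1) (neg_part u) (\<lambda>p. (0, -1))"
  unfolding C1alpha_grad_def
proof (intro conjI ballI)
  let ?S = "closure (Omega_minus u) \<inter> B1"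
  have "continuous_on ?S (\<lambda>p. max (- snd p) 0)"
    by (intro continuous_intros)
  then show "continuous_on ?S (neg_part u)"
    by (subst continuous_on_cong[OF refl neg_part_u]) auto
  show "(neg_part u has_derivative (\<lambda>h. (0, -1) \<bullet> h)) (at p)" if "p \<in> interior ?S" for p
    using that interior_closure_Omega_minus has_derivative_neg_part_u by blast
  show "\<exists>r>0. \<exists>C. \<forall>y\<in>?S \<inter> ball x r. \<forall>z\<in>?S \<inter> ball x r.
      norm ((0::real, -1::real) - (0, -1)) \<le> C * dist y z powr (1/2)" for x
    by (intro exI[of _ "1::real"] conjI ballI) simp_all
qed

text \<open>The term \<open>exp_inv (y - 1/2)\<close> destroys analyticity at \<open>(0, 1/2)\<close> and vanishes on both free boundaries,
  which lie in \<open>y \<le> 1/4\<close>.\<close>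

definition Lp :: "R2 \<Rightarrow> real" where
  "Lp p = grad_sq (fst p) + exp_inv (snd p - 1 / 2)"

definition Lm :: "R2 \<Rightarrow> real" where
  "Lm p = 1 + exp_inv (snd p - 1 / 2)"

lemma two_phase_solution_u: "two_phase_solution Lp Lm u"
proof -
  have p: "(norm (Gp p))\<^sup>2 = Lp p" if "p \<in> frontier (Omega_plus u)" "p \<in> B1" for p
  proof -
    have "snd p = g (fst p)" using frontier_Omega_plus that by blast
    moreover have "g (fst p) \<le> 1 / 4" using g(2)[of "fst p"] B1_bounds[OF that(2)] by simp
    ultimately show ?thesis
      by (simp add: Lp_def grad_sq_def \<zeta>_def Gp_def norm_Pair cmod_power2 exp_inv_def)
  qed
  have m: "(norm (0::real, -1::real))\<^sup>2 = Lm p" if "p \<in> frontier (Omega_minus u)" "p \<in> B1" for p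
    using frontier_Omega_minus[OF that] by (simp add: Lm_def norm_Pair exp_inv_def)
  have z: "pos_part u p = 0" if "p \<in> frontier (Omega_plus u)" "p \<in> B1" for p
    using frontier_Omega_plus[OF that] pos_part_u that by simp
  have z': "neg_part u p = 0" if "p \<in> frontier (Omega_minus u)" "p \<in> B1" for p
    using frontier_Omega_minus[OF that] neg_part_u that by simp
  show ?thesis
    unfolding two_phase_solution_def Let_def
    by (rule conjI, rule exI[of _ 3], rule u_lipschitz,
        intro conjI exI[of _ "1/2::real"] exI[of _ Gp] exI[of _ "\<lambda>p::R2. (0::real, -1::real)"])
      (use C1alpha_boundary_Omega_plus C1alpha_boundary_Omega_minus C1alpha_grad_pos_part_u
      C1alpha_grad_neg_part_u harmonic_pos_part_u harmonic_neg_part_u p m z z' in \<open>auto simp del: norm_Pair\<close>)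
qed

lemma smooth_Lp: "smooth_on B1 Lp" and smooth_Lm: "smooth_on B1 Lm"
proof -
  have e: "Ck_real_on k UNIV (\<lambda>y. exp_inv (y - 1 / 2))" for k
    using Ck_real_on_affine[OF Ck_real_exp_inv, of k 1 "- 1 / 2"] by simp
  have B: "B1 \<subseteq> {-2<..<2} \<times> UNIV" using B1_bounds by force
  show "smooth_on B1 Lp"
    unfolding smooth_on_def Lp_def using Ck_on_add_separate[OF Ck_real_on_grad_sq e B] by blast
  show "smooth_on B1 Lm"
    unfolding smooth_on_def Lm_def using Ck_on_add_separate[OF Ck_real_on_const e B] by blast
qed

lemma branching_set_u:
  assumes F: "F \<subseteq> {-1..1}" "interior F = {}"
  shows "branching_set u = (\<lambda>t. (t, 0)) ` F"
proof (intro equalityI subsetI)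
  fix p assume "p \<in> branching_set u"
  then have "p \<in> closure (Omega_plus u)" "p \<in> closure (Omega_minus u)"
    by (auto simp: branching_set_def frontier_def)
  then have p: "\<bar>fst p\<bar> \<le> 1" "\<bar>snd p\<bar> \<le> 1" "v p \<ge> 0" "snd p \<le> 0"
    using closure_Omega_plus closure_Omega_minus by blast+
  then have "snd p \<ge> g (fst p)"
    using v_sign[of "fst p" "snd p"] by (cases p) (auto simp: le_less)
  moreover have "g (fst p) \<ge> 0" using g(1) p by simp
  ultimately have "snd p = 0" "g (fst p) = 0" using p by auto
  then have "fst p \<in> F" using g_eq_0_iff[of "fst p"] p by simp
  then show "p \<in> (\<lambda>t. (t, 0)) ` F" using \<open>snd p = 0\<close> by (cases p) auto
next
  fix p assume "p \<in> (\<lambda>t. (t, 0::real)) ` F"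
  then obtain x where x: "x \<in> F" "p = (x, 0)" by auto
  have x1: "\<bar>x\<bar> \<le> 1" using F x unfolding abs_le_iff by auto
  have g0: "g x = 0" using g_eq_0_iff[of x] x x1 by simp
  have near: "\<exists>s. 0 < s \<and> s < 1 \<and> (s * x, (1 - s) / 2) \<in> B1 \<and> (s * x, - (1 - s) / 2) \<in> B1 \<and>
      dist (s * x, (1 - s) / 2) p < e \<and> dist (s * x, - (1 - s) / 2) p < e" if "e > 0" for e
  proof -
    define s where "s = 1 - min (1/2) (e / 2)"
    have s: "0 < s" "s < 1" "1 - s \<le> e / 2" using that by (auto simp: s_def)
    have "x\<^sup>2 \<le> 1" using x1 by (simp add: abs_square_le_1)
    then have "(s * x)\<^sup>2 + ((1 - s) / 2)\<^sup>2 \<le> s\<^sup>2 * 1 + (1 - s)\<^sup>2 * 1 / 4"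
      by (simp add: power_mult_distrib power_divide mult_left_le)
    also have "\<dots> < 1"
    proof -
      have "s\<^sup>2 < s * 1" "(1 - s)\<^sup>2 \<le> (1 - s) * 1"
        unfolding power2_eq_square using s by (auto intro!: mult_strict_left_mono mult_left_mono)
      then show ?thesis using s by simp
    qed
    finally have in_B1: "(s * x, (1 - s) / 2) \<in> B1" "(s * x, - (1 - s) / 2) \<in> B1"
      by (auto simp: mem_B1_iff power_divide power2_commute[of s 1])
    have d: "dist (s * x, t) p \<le> (1 - s) + \<bar>t\<bar>" for t
    proof -
      have "dist (s * x, t) p \<le> \<bar>s * x - x\<bar> + \<bar>t\<bar>"
        using sqrt_sum_squares_le_sum_abs[of "s * x - x" t] by (simp add: x dist_prod_def dist_real_def)
      also have "s * x - x = - ((1 - s) * x)" by (simp add: algebra_simps)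
      also have "\<bar>- ((1 - s) * x)\<bar> \<le> 1 - s"
        using x1 s by (simp add: abs_mult mult_left_le)
      finally show ?thesis by simp
    qed
    have "dist (s * x, (1 - s) / 2) p < e" "dist (s * x, - (1 - s) / 2) p < e"
    proof -
      have "(1 - s) + \<bar>(1 - s) / 2\<bar> < e" "\<bar>- (1 - s) / 2\<bar> = \<bar>(1 - s) / 2\<bar>"
        using s by (simp_all add: field_simps)
      then show "dist (s * x, (1 - s) / 2) p < e" "dist (s * x, - (1 - s) / 2) p < e"
        using d[of "(1 - s) / 2"] d[of "- (1 - s) / 2"] by simp_all
    qed
    with s in_B1 show ?thesis by blast
  qed
  have "p \<in> closure (Omega_plus u)"
    unfolding closure_approachable
  proof (intro allI impI)
    fix e :: real assume "e > 0"
    from near[OF this] obtain s where s: "0 < s" "s < 1" "(s * x, (1 - s) / 2) \<in> B1"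
      "dist (s * x, (1 - s) / 2) p < e" by blast
    have sx: "\<bar>s * x\<bar> \<le> 1" using B1_bounds[OF s(3)] by simp
    have "g (s * x) \<le> \<bar>s * x - x\<bar> / 3"
      using g_lipschitz[of "s * x" x] g0 sx x1 by simp
    also have "\<bar>s * x - x\<bar> = \<bar>(1 - s) * x\<bar>"
      by (simp add: algebra_simps abs_minus_commute)
    also have "\<dots> \<le> 1 - s" using x1 s by (simp add: abs_mult mult_left_le)
    finally have "g (s * x) < (1 - s) / 2" using s by simp
    then have "(s * x, (1 - s) / 2) \<in> Omega_plus u"
      using s sx v_sign(1)[of "s * x" "(1 - s) / 2"] by (simp add: Omega_plus_u)
    with s show "\<exists>y\<in>Omega_plus u. dist y p < e" by blast
  qed
  moreover have "p \<notin> Omega_plus u"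
    using v_sign(1)[of x 0] x x1 g0 by (simp add: Omega_plus_u)
  moreover have "p \<in> closure (Omega_minus u)"
    unfolding closure_approachable
  proof (intro allI impI)
    fix e :: real assume "e > 0"
    from near[OF this] obtain s where s: "0 < s" "s < 1" "(s * x, - (1 - s) / 2) \<in> B1"
      "dist (s * x, - (1 - s) / 2) p < e" by blast
    then have "(s * x, - (1 - s) / 2) \<in> Omega_minus u" by (simp add: Omega_minus_u)
    with s show "\<exists>y\<in>Omega_minus u. dist y p < e" by blast
  qed
  moreover have "p \<notin> Omega_minus u" by (simp add: Omega_minus_u x)
  moreover have "p \<in> closure (interior {x \<in> B1. u x = 0})"
    unfolding closure_approachable
  proof (intro allI impI)
    fix e :: real assume "e > 0"
    have "\<exists>t. \<bar>t\<bar> < 1 \<and> \<bar>t - x\<bar> < e / 2 \<and> t \<notin> F"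
    proof (rule ccontr)
      assume *: "\<not> ?thesis"
      have "{-1<..<1} \<inter> {x - e / 2<..<x + e / 2} \<subseteq> F"
      proof
        fix t assume t: "t \<in> {-1<..<1} \<inter> {x - e / 2<..<x + e / 2}"
        then have "\<bar>t\<bar> < 1" "\<bar>t - x\<bar> < e / 2" unfolding abs_less_iff by auto
        with * show "t \<in> F" by blast
      qed
      then have "{-1<..<1} \<inter> {x - e / 2<..<x + e / 2} \<subseteq> interior F"
        by (intro interior_maximal) auto
      moreover have "max (-1) (x - e / 2) < min 1 (x + e / 2)"
        using x1 \<open>e > 0\<close> by auto
      then have "(max (-1) (x - e / 2) + min 1 (x + e / 2)) / 2 \<in> {-1<..<1} \<inter> {x - e / 2<..<x + e / 2}"
        by auto
      ultimately show False using F(2) by blast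
    qed
    then obtain t where t: "\<bar>t\<bar> < 1" "\<bar>t - x\<bar> < e / 2" "t \<notin> F" by blast
    then have gt: "g t > 0" using g_eq_0_iff[of t] g(1)[of t] by simp
    define y where "y = min (g t) (min (e / 2) (1 - \<bar>t\<bar>)) / 2"
    have y: "0 < y" "y < g t" "y < e / 2" "y < 1 - \<bar>t\<bar>"
      using gt t \<open>e > 0\<close> by (auto simp: y_def)
    let ?Z = "B1 \<inter> v -` {..<0} \<inter> snd -` {0<..}"
    have "open ?Z"
      using continuous_open_preimage[OF continuous_on_v_B1 open_B1, of "{..<0}"] by (simp add: open_Int open_vimage_snd)
    moreover have "?Z \<subseteq> {x \<in> B1. u x = 0}" by (auto simp: u_def)
    moreover have "(t, y) \<in> ?Z"
    proof -
      have "(t, y) \<in> B1"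
        unfolding B1_def mem_ball dist_prod_def dist_real_def fst_conv snd_conv
        using sqrt_sum_squares_le_sum_abs[of t y] y(1,4) by (simp del: real_sqrt_lt_1_iff)
      moreover have "v (t, y) < 0"
        using v_sign[of t y] y t g(2)[of t] by (simp add: not_less linorder_neq_iff)
      ultimately show ?thesis using y by simp
    qed
    ultimately have "(t, y) \<in> interior {x \<in> B1. u x = 0}"
      using interior_maximal by blast
    moreover have "dist (t, y) p < e"
      using sqrt_sum_squares_le_sum_abs[of "t - x" y] t y by (simp add: x dist_prod_def dist_real_def)
    ultimately show "\<exists>y\<in>interior {x \<in> B1. u x = 0}. dist y p < e" by blast
  qed
  ultimately show "p \<in> branching_set u"
    by (simp add: branching_set_def frontier_def interior_open open_Omega_plus open_Omega_minus)
qed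

end

theorem theorem1p2:
  fixes K :: "real set"
  assumes "compact K" and "K \<subseteq> {-1..1}"
  shows "\<exists>\<Lambda>p \<Lambda>m u.
     (\<forall>x\<in>B1. \<Lambda>p x > 0) \<and> (\<forall>x\<in>B1. \<Lambda>m x > 0) \<and>
     smooth_on B1 \<Lambda>p \<and> \<not> real_analytic_on B1 \<Lambda>p \<and>
     smooth_on B1 \<Lambda>m \<and> \<not> real_analytic_on B1 \<Lambda>m \<and>
     two_phase_solution \<Lambda>p \<Lambda>m u \<and>
     branching_set u = (\<lambda>t. (t, 0)) ` frontier K"
proof -
  \<comment> \<open>The free boundaries are made to touch only on \<open>frontier K\<close>, which is closed with empty interior,
    and not on all of \<open>K\<close>; the inequalities at two-phase points then hold with equality.\<close>
  have "closed K" using assms(1) by (rule compact_imp_closed)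
  have F: "closed (frontier K)" "frontier K \<subseteq> {-1..1}" "interior (frontier K) = {}"
  proof -
    show "closed (frontier K)" by simp
    show "frontier K \<subseteq> {-1..1}"
      using frontier_subset_closed[OF \<open>closed K\<close>] assms(2) by blast
    have "interior (frontier K) \<subseteq> interior K"
      using frontier_subset_closed[OF \<open>closed K\<close>] by (rule interior_mono)
    moreover have "interior (frontier K) \<subseteq> frontier K" by (rule interior_subset)
    ultimately show "interior (frontier K) = {}"
      by (auto simp: frontier_def)
  qed
  obtain H where "boundary_perturbation (frontier K) H"
    by (rule smooth_holomorphic_with_boundary_zeros[OF F(1)]) (rule that, unfold_locales)
  then interpret boundary_perturbation "frontier K" H .
  show ?thesis
  proof (intro exI conjI)
    show "\<forall>x\<in>B1. Lp x > 0"
      using grad_sq_pos exp_inv_nonneg B1_bounds by (force simp: Lp_def intro: add_pos_nonneg)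
    show "\<forall>x\<in>B1. Lm x > 0"
      using exp_inv_nonneg by (auto simp: Lm_def intro: add_pos_nonneg)
    show "\<not> real_analytic_on B1 Lp"
      unfolding Lp_def by (rule not_real_analytic_add_exp_inv)
    show "\<not> real_analytic_on B1 Lm"
      unfolding Lm_def using not_real_analytic_add_exp_inv[of "\<lambda>_. 1"] by simp
    show "branching_set u = (\<lambda>t. (t, 0)) ` frontier K"
      by (rule branching_set_u[OF F(2,3)])
  qed (rule smooth_Lp smooth_Lm two_phase_solution_u)+
qed

end
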